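(* Let $(T_\delta)_{\delta\in[0,\bar\delta)}$ be a family of $C^3$ expanding orientation preserving maps of the circle $S^1$ such that $$T_\delta(x)=T_0(x)+\delta\dot T(x)+o_{C^3}(\delta),\qquad \dot T\in C^3(S^1,\mathbb R).$$ Let $L_\delta$ be the transfer operator of $T_\delta$ and let $f_\delta\in C^2(S^1,\mathbb R)$ be the invariant probability density of $T_\delta$. Then $$\lim_{\delta\to0}\left\|\frac{f_\delta-f_0}{\delta}-(1-L_0)^{-1}\dot Lf_0\right\|_{L^1}=0,$$ where $$\dot Lw=-L_0\left(\frac{w\dot T'}{T_0'}\right)-L_0\left(\frac{\dot Tw'}{T_0'}\right)+L_0\left(\frac{\dot TT_0''}{T_0'^2}w\right),\qquad w\in C^2(S^1,\mathbb R).$$ Hence there is a linear response formula $\lim_{\delta\to0}\frac{f_\delta-f_0}{\delta}=(1-L_0)^{-1}\dot Lf_0$, with convergence in $L^1$.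
   Context: $S^1=\mathbb R/\mathbb Z$ with normalized Lebesgue measure. A map $T$ of the circle is expanding if $|T'(x)|>1$ for all $x$. The transfer operator is $[L_\delta f](x)=\sum_{y\in T_\delta^{-1}(x)}\frac{f(y)}{|T_\delta'(y)|}$. $o_{C^3}(\delta)$ denotes a term whose $C^3$ norm divided by $\delta$ tends to $0$ as $\delta\to0$. $(1-L_0)^{-1}:=\sum_{i=0}^\infty L_0^i$, acting on zero-average functions in $W^{1,1}$ (absolutely continuous functions with norm $\|f\|_1+\|f'\|_1$), the series converging in $L^1$. *)

theory Defs
  imports "HOL-Analysis.Analysis"
begin

text \<open>
  The circle is the quotient of the reals by the integers. Functions on it are represented by
  1-periodic functions on the reals, maps of it to itself by lifts to the reals. A lift is only
  determined up to an integer constant, and every notion below is insensitive to that choice.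
\<close>

definition periodic :: "(real \<Rightarrow> 'a) \<Rightarrow> bool" where
  "periodic f \<longleftrightarrow> (\<forall>x. f (x + 1) = f x)"

definition lift_of_circle_map :: "(real \<Rightarrow> real) \<Rightarrow> bool" where
  "lift_of_circle_map T \<longleftrightarrow> (\<forall>x. T (x + 1) - T x \<in> \<int>)"

definition Ck :: "nat \<Rightarrow> (real \<Rightarrow> real) \<Rightarrow> bool" where
  "Ck k f \<longleftrightarrow> (\<forall>i<k. \<forall>x. (deriv ^^ i) f differentiable (at x)) \<and>
    continuous_on UNIV ((deriv ^^ k) f)"

text \<open>The suprema are finite when \<open>f\<close> is periodic and \<open>Ck k f\<close> holds, the only case in which
  the norm is used.\<close>

definition Ck_norm :: "nat \<Rightarrow> (real \<Rightarrow> real) \<Rightarrow> real" where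
  "Ck_norm k f = (\<Sum>i\<le>k. SUP x. \<bar>(deriv ^^ i) f x\<bar>)"

definition expanding :: "(real \<Rightarrow> real) \<Rightarrow> bool" where
  "expanding T \<longleftrightarrow> (\<forall>x. \<bar>deriv T x\<bar> > 1)"

definition orientation_preserving :: "(real \<Rightarrow> real) \<Rightarrow> bool" where
  "orientation_preserving T \<longleftrightarrow> (\<forall>x. deriv T x > 0)"

text \<open>Normalized Lebesgue measure on the circle, on the fundamental domain \<open>{0..<1}\<close>.\<close>

definition circle_measure :: "real measure" where
  "circle_measure = restrict_space lborel {0..<1}"

definition L1_norm :: "(real \<Rightarrow> real) \<Rightarrow> real" where
  "L1_norm f = (\<integral>x. \<bar>f x\<bar> \<partial>circle_measure)"

definition L1 :: "(real \<Rightarrow> real) set" where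
  "L1 = {f. periodic f \<and> integrable circle_measure f}"

definition L1_tendsto :: "('i \<Rightarrow> real \<Rightarrow> real) \<Rightarrow> (real \<Rightarrow> real) \<Rightarrow> 'i filter \<Rightarrow> bool" where
  "L1_tendsto u h F \<longleftrightarrow> h \<in> L1 \<and> (\<forall>\<^sub>F i in F. u i \<in> L1) \<and>
    ((\<lambda>i. L1_norm (\<lambda>x. u i x - h x)) \<longlongrightarrow> 0) F"

definition abs_continuous :: "(real \<Rightarrow> real) \<Rightarrow> bool" where
  "abs_continuous f \<longleftrightarrow>
    (\<forall>\<epsilon>>0. \<exists>\<eta>>0. \<forall>n a b.
      (\<forall>i<n. 0 \<le> a i \<and> a i \<le> b i \<and> b i \<le> 1) \<and>
      disjoint_family_on (\<lambda>i. {a i<..<b i}) {..<n::nat} \<and>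
      (\<Sum>i<n. b i - a i) < \<eta>
      \<longrightarrow> (\<Sum>i<n. \<bar>f (b i) - f (a i)\<bar>) < \<epsilon>)"

definition W11_zero_average :: "(real \<Rightarrow> real) set" where
  "W11_zero_average = {f. periodic f \<and> abs_continuous f \<and> (\<integral>x. f x \<partial>circle_measure) = 0}"

text \<open>The index set below contains exactly one representative of each preimage, under the
  circle map, of the class of \<open>x\<close>.\<close>

definition transfer :: "(real \<Rightarrow> real) \<Rightarrow> (real \<Rightarrow> real) \<Rightarrow> real \<Rightarrow> real" where
  "transfer T f x = (\<Sum>y\<in>{y\<in>{0..<1}. T y - x \<in> \<int>}. f y / \<bar>deriv T y\<bar>)"

text \<open>Invariance is that of the measure: it is equal to its own image under the circle map, which
  in the fundamental domain is \<open>\<lambda>x. frac (T x)\<close>.\<close>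

definition invariant_probability_density :: "(real \<Rightarrow> real) \<Rightarrow> (real \<Rightarrow> real) \<Rightarrow> bool" where
  "invariant_probability_density T f \<longleftrightarrow>
    periodic f \<and> (\<forall>x. 0 \<le> f x) \<and>
    (\<integral>x. f x \<partial>circle_measure) = 1 \<and>
    distr (density circle_measure (\<lambda>x. ennreal (f x))) circle_measure (\<lambda>x. frac (T x)) =
      density circle_measure (\<lambda>x. ennreal (f x))"

definition transfer_series_tendsto ::
    "(real \<Rightarrow> real) \<Rightarrow> (real \<Rightarrow> real) \<Rightarrow> (real \<Rightarrow> real) \<Rightarrow> bool" where
  "transfer_series_tendsto T g h \<longleftrightarrow>
    L1_tendsto (\<lambda>n x. \<Sum>i<n. (transfer T ^^ i) g x) h sequentially"

text \<open>The operator \<open>(1 - L)\<^sup>-\<^sup>1\<close> on \<^const>\<open>W11_zero_average\<close>. The limit is unique only up to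
  null sets, so a representative is chosen.\<close>

definition resolvent :: "(real \<Rightarrow> real) \<Rightarrow> (real \<Rightarrow> real) \<Rightarrow> real \<Rightarrow> real" where
  "resolvent T g = (SOME h. transfer_series_tendsto T g h)"

definition Ldot :: "(real \<Rightarrow> real) \<Rightarrow> (real \<Rightarrow> real) \<Rightarrow> (real \<Rightarrow> real) \<Rightarrow> real \<Rightarrow> real" where
  "Ldot T V w = (\<lambda>x.
    - transfer T (\<lambda>y. w y * deriv V y / deriv T y) x
    - transfer T (\<lambda>y. V y * deriv w y / deriv T y) x
    + transfer T (\<lambda>y. V y * deriv (deriv T) y / (deriv T y)\<^sup>2 * w y) x)"

end

theory Submission
  imports Defs
begin

text \<open>
  Write \<open>L\<close> for the transfer operator of \<open>T 0\<close> and \<open>L\<^sub>\<delta>\<close> for that of \<open>T \<delta>\<close>. The invariant densities are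
  fixed points of these operators, so
  \<open>(1 - L\<^sub>\<delta>) (f \<delta> - f 0) = L\<^sub>\<delta> (f 0) - L (f 0)\<close>, and inverting \<open>1 - L\<^sub>\<delta>\<close> by its Neumann series gives
  \<open>(f \<delta> - f 0) / \<delta> = (\<Sum>n. L\<^sub>\<delta>\<^sup>n (q \<delta>))\<close> with \<open>q \<delta> = (L\<^sub>\<delta> (f 0) - L (f 0)) / \<delta>\<close>. Written with the powers of
  \<open>L\<^sub>\<delta>\<close>, and not of \<open>L\<close>, the formula applies the difference of the two operators to the fixed
  function \<open>f 0\<close>. The theorem says that the limit \<open>\<delta> \<rightarrow> 0\<close> can be taken in each term of the series.
  This rests on two facts, both of which hold in the supremum norm; convergence in \<open>L\<^sup>1\<close> is then a
  consequence of uniform convergence.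

  The first is exponential decay (\<open>zero_average_decay\<close>): \<open>L\<^sub>\<delta>\<^sup>n g\<close> is at most a multiple of \<open>\<theta>\<^sup>n\<close>, with
  \<open>\<theta> < 1\<close> independent of \<open>\<delta>\<close>, for \<open>g\<close> of zero average with a given bound on \<open>g\<close> and \<open>g'\<close>. It is a
  coupling argument. Expansion makes \<open>L\<^sub>\<delta>\<close> map the cone of positive functions with \<open>\<bar>g'\<bar> \<le> a * g\<close>
  strictly inside itself (\<open>transfer_cone\<close>). An image in the smaller cone is bounded below by a
  multiple of its mean, and there is room to subtract a fixed fraction \<open>c\<close> of the mean without
  leaving the larger cone (\<open>transfer_minus_mass_cone\<close>). For two functions of equal mean the same
  constant is subtracted, so that their difference is unchanged while both means shrink by the
  factor \<open>1 - c\<close> (\<open>cone_coupling\<close>). A function of zero average is the difference of two members of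
  the cone with equal mean.

  The second is the behaviour of \<open>q \<delta>\<close>. Joining \<open>T 0\<close> to \<open>T \<delta>\<close> by a segment of maps and
  differentiating the branches of the inverse along it, the mean value theorem expresses
  \<open>L\<^sub>\<delta> w - L w\<close> as the variation of the transfer operator at some map of the segment
  (\<open>transfer_segment_mvt\<close>). The transfer operator is continuous in the map (\<open>transfer_stable\<close>), whence
  \<open>q \<delta>\<close> tends uniformly to the function that \<^const>\<open>Ldot\<close> yields (\<open>first_order_response\<close>). Since the
  derivative of \<open>L w\<close> is again a transfer operator applied to a \<open>C\<^sup>1\<close> function, the same result
  bounds the derivative of \<open>q \<delta>\<close> (\<open>difference_quotient_C1_bounded\<close>), as the decay estimate requires.

  The pointwise sum of the limit terms is a limit in \<open>L\<^sup>1\<close> of the same series as the chosen limit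
  \<^const>\<open>resolvent\<close>, so the two agree up to a null set.
\<close>

section \<open>Periodic functions\<close>

lemma periodic_shift_int:
  assumes "periodic f"
  shows "f (x + of_int k) = f x"
proof (induction k rule: int_induct[where k = 0])
  case (step1 i)
  have "f (x + of_int i + 1) = f (x + of_int i)" using assms by (simp add: periodic_def)
  with step1 show ?case by (simp add: add.assoc)
next
  case (step2 i)
  have "f (x + of_int (i - 1) + 1) = f (x + of_int (i - 1))"
    using assms unfolding periodic_def by blast
  with step2 show ?case by simp
qed simp

lemma periodic_cong_Ints:
  assumes "periodic f" "x - y \<in> \<int>"
  shows "f x = f y"
proof -
  obtain k where "x - y = of_int k" using assms(2) by (auto elim: Ints_cases)
  hence "x = y + of_int k" by simp
  thus ?thesis using periodic_shift_int[OF assms(1)] by simp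
qed

lemma periodic_frac: "periodic f \<Longrightarrow> f (frac x) = f x"
  by (rule periodic_cong_Ints) (auto simp: frac_def)

text \<open>
  With \<open>c = 0\<close> this is about periodic functions; lifts of circle maps need \<open>c\<close> to be the degree.
\<close>

lemma quasi_periodic_deriv:
  assumes "\<And>x. (g has_real_derivative g1 x) (at x)" "\<And>x. g (x + 1) = g x + c"
  shows "periodic g1"
  unfolding periodic_def
proof
  fix x
  have "((\<lambda>x. g (x + 1)) has_real_derivative g1 (x + 1)) (at x)"
    using assms(1)[of "x + 1"] by (simp add: DERIV_shift)
  moreover have "((\<lambda>x. g x + c) has_real_derivative g1 x) (at x)"
    by (auto intro!: derivative_eq_intros assms(1))
  ultimately show "g1 (x + 1) = g1 x"
    using assms(2) by (simp add: DERIV_unique)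
qed

lemma periodic_deriv:
  assumes "\<And>x. (g has_real_derivative g1 x) (at x)" "periodic g"
  shows "periodic g1"
  using quasi_periodic_deriv[of g g1 0] assms by (simp add: periodic_def)

lemma periodic_continuous_bound:
  fixes f :: "real \<Rightarrow> real"
  assumes "periodic f" "continuous_on UNIV f"
  obtains K where "K > 0" "\<And>x. \<bar>f x\<bar> \<le> K"
proof -
  have "compact (f ` {0..1})"
    using assms(2) by (intro compact_continuous_image) (auto intro: continuous_on_subset)
  then obtain B where B: "B > 0" "\<And>x. x \<in> {0..1} \<Longrightarrow> \<bar>f x\<bar> \<le> B"
    using compact_imp_bounded bounded_pos by (metis imageI real_norm_def)
  have "\<bar>f x\<bar> \<le> B" for x
    using B(2)[of "frac x"] periodic_frac[OF assms(1), of x] frac_lt_1[of x] by simp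
  with B(1) show thesis by (rule that)
qed

lemma periodic_uniformly_continuous:
  fixes f :: "real \<Rightarrow> real"
  assumes "periodic f" "continuous_on UNIV f" "e > 0"
  obtains r where "r > 0" "\<And>x y. \<bar>x - y\<bar> \<le> r \<Longrightarrow> \<bar>f x - f y\<bar> \<le> e"
proof -
  have "uniformly_continuous_on {-1..2} f"
    using assms(2) by (intro compact_uniformly_continuous) (auto intro: continuous_on_subset)
  then obtain r where r: "r > 0" "\<And>x y. x \<in> {-1..2} \<Longrightarrow> y \<in> {-1..2} \<Longrightarrow> \<bar>y - x\<bar> < r \<Longrightarrow> \<bar>f y - f x\<bar> < e"
    unfolding uniformly_continuous_on_def dist_real_def using \<open>e > 0\<close> by metis
  define r' where "r' = min 1 (r / 2)"
  show thesis
  proof (rule that[of r'])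
    show "r' > 0" using r(1) by (simp add: r'_def)
    fix x y :: real assume xy: "\<bar>x - y\<bar> \<le> r'"
    define k where "k = \<lfloor>y\<rfloor>"
    have "y - of_int k \<in> {0..1}" unfolding k_def using frac_lt_1[of y] frac_ge_0[of y]
      by (auto simp: frac_def)
    moreover have "\<bar>x - y\<bar> \<le> 1" "\<bar>x - y\<bar> < r" using xy r(1) by (auto simp: r'_def)
    ultimately have "\<bar>f (x - of_int k) - f (y - of_int k)\<bar> < e"
      by (intro r(2)) (auto simp: abs_le_iff)
    thus "\<bar>f x - f y\<bar> \<le> e"
      using periodic_shift_int[OF assms(1), of _ "- k"] by simp
  qed
qed

lemma continuous_primitive:
  fixes f :: "real \<Rightarrow> real"
  assumes "continuous_on UNIV f"
  obtains F where "\<And>x. (F has_real_derivative f x) (at x)"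
proof -
  have "isCont f x" for x using assms by (simp add: continuous_on_eq_continuous_at)
  then obtain F where "\<forall>x::real. -\<infinity> < ereal x \<longrightarrow> ereal x < \<infinity> \<longrightarrow> (F has_vector_derivative f x) (at x)"
    using einterval_antiderivative[of "-\<infinity>" "\<infinity>" f] by auto
  hence "\<And>x. (F has_real_derivative f x) (at x)"
    by (simp add: has_real_derivative_iff_has_vector_derivative)
  thus thesis by (rule that)
qed

lemma integral_eq_primitive:
  fixes f :: "real \<Rightarrow> real"
  assumes "\<And>x. (F has_real_derivative f x) (at x)"
  shows "integral {0..1} f = F 1 - F 0"
proof -
  have "(f has_integral (F 1 - F 0)) {0..1}"
    by (intro fundamental_theorem_of_calculus)
      (auto simp: has_real_derivative_iff_has_vector_derivative[symmetric]
        intro: has_field_derivative_at_within assms)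
  thus ?thesis by blast
qed

text \<open>
  Lifts of the same circle map differ by integers at each point. This makes the difference a
  constant, and likewise makes the degree of a lift well defined.
\<close>

lemma continuous_Ints_constant:
  fixes f :: "real \<Rightarrow> real"
  assumes "continuous_on UNIV f" "\<And>x. f x \<in> \<int>"
  shows "f x = f y"
proof -
  have "f constant_on UNIV"
  proof (rule continuous_discrete_range_constant)
    fix x
    have "1 \<le> norm (f y - f x)" if "f y \<noteq> f x" for y
    proof -
      have "f y - f x \<in> \<int>" using assms(2) by simp
      then obtain k where k: "f y - f x = of_int k" by (auto elim: Ints_cases)
      with that have "k \<noteq> 0" by auto
      thus ?thesis unfolding k by simp
    qed
    thus "\<exists>e>0. \<forall>y. y \<in> UNIV \<and> f y \<noteq> f x \<longrightarrow> e \<le> norm (f y - f x)" by (intro exI[of _ 1]) auto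
  qed (use assms in auto)
  thus ?thesis by (metis constant_on_def UNIV_I)
qed

section \<open>The transfer operator as a positive operator\<close>

text \<open>
  This and the rules below hold for every \<open>T\<close>: where the set of preimages is infinite, all the sums
  are zero.
\<close>

lemma transfer_periodic: "periodic (transfer T g)"
proof -
  have "{y \<in> {0..<1}. T y - (x + 1) \<in> \<int>} = {y \<in> {0..<1}. T y - x \<in> \<int>}" for x
  proof -
    have "T y - (x + 1) \<in> \<int> \<longleftrightarrow> T y - x \<in> \<int>" for y
      using Ints_add[of "T y - (x + 1)" 1] Ints_diff[of "T y - x" 1] by (auto simp: algebra_simps)
    thus ?thesis by simp
  qed
  thus ?thesis by (simp add: periodic_def transfer_def)
qed

lemma transfer_linear:
  "transfer T (\<lambda>y. a * f y + b * g y) x = a * transfer T f x + b * transfer T g x"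
  by (simp add: transfer_def sum.distrib sum_distrib_left add_divide_distrib)

lemma transfer_diff: "transfer T (\<lambda>y. f y - g y) x = transfer T f x - transfer T g x"
  using transfer_linear[of T 1 f "-1" g x] by simp

lemma transfer_cmult: "transfer T (\<lambda>y. a * f y) x = a * transfer T f x"
  using transfer_linear[of T a f 0 f x] by simp

lemma transfer_mono: "(\<And>y. f y \<le> g y) \<Longrightarrow> transfer T f x \<le> transfer T g x"
  unfolding transfer_def by (intro sum_mono divide_right_mono) auto

lemma transfer_abs_le:
  assumes "\<And>y. \<bar>f y\<bar> \<le> g y"
  shows "\<bar>transfer T f x\<bar> \<le> transfer T g x"
proof -
  have "\<bar>transfer T f x\<bar> \<le> (\<Sum>y\<in>{y\<in>{0..<1}. T y - x \<in> \<int>}. \<bar>f y / \<bar>deriv T y\<bar>\<bar>)"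
    unfolding transfer_def by (rule sum_abs)
  also have "\<dots> = transfer T (\<lambda>y. \<bar>f y\<bar>) x" by (simp add: transfer_def abs_divide)
  also have "\<dots> \<le> transfer T g x" by (rule transfer_mono) (rule assms)
  finally show ?thesis .
qed

lemma transfer_pow_diff:
  "(transfer T ^^ n) (\<lambda>y. f y - g y) = (\<lambda>x. (transfer T ^^ n) f x - (transfer T ^^ n) g x)"
  by (induction n) (auto simp: transfer_diff)

section \<open>Expanding lifts\<close>

text \<open>
  The bounds \<open>l\<close> and \<open>D\<close> are parameters because the rate of decay depends on the map through
  them alone. Members of a family that share them share the rate.
\<close>

locale expanding_lift =
  fixes T T1 T2 :: "real \<Rightarrow> real" and d :: nat and l D :: real
  assumes deriv_T: "(T has_real_derivative T1 x) (at x)"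
    and deriv_T1: "(T1 has_real_derivative T2 x) (at x)"
    and degree: "T (x + 1) = T x + real d"
    and l_gt_1: "1 < l" and T1_ge: "l \<le> T1 x" and T2_le: "\<bar>T2 x\<bar> \<le> D"
begin

lemma T1_gt_1: "1 < T1 x" using l_gt_1 T1_ge[of x] by simp

lemma T1_pos: "0 < T1 x" using T1_gt_1[of x] by simp

lemma T1_nz: "T1 x \<noteq> 0" using T1_pos[of x] by simp

lemma D_nonneg: "0 \<le> D" using T2_le[of 0] by simp

lemma deriv_T_eq: "deriv T x = T1 x"
  by (rule DERIV_imp_deriv) (rule deriv_T)

lemma T1_periodic: "periodic T1"
  by (rule quasi_periodic_deriv[of T _ "real d"]) (auto intro: deriv_T degree)

lemma T2_periodic: "periodic T2"
  by (rule periodic_deriv[of T1]) (auto intro: deriv_T1 T1_periodic)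

lemma T1_cont: "continuous_on UNIV T1"
  by (rule DERIV_continuous_on) (rule has_field_derivative_at_within[OF deriv_T1])

lemma T_expands_less:
  assumes "x < y" shows "y - x < T y - T x"
proof -
  obtain z where "T y - T x = (y - x) * T1 z"
    using MVT2[OF assms, of T T1] deriv_T by blast
  thus ?thesis using assms T1_gt_1[of z] by (simp add: mult_less_cancel_left1)
qed

lemma T_expands: "\<bar>x - y\<bar> \<le> \<bar>T x - T y\<bar>"
  using T_expands_less[of x y] T_expands_less[of y x] by (cases x y rule: linorder_cases) auto

lemma d_pos: "0 < d"
  using T_expands_less[of 0 1] degree[of 0] by simp

lemma T_inj: "T x = T y \<Longrightarrow> x = y"
  using T_expands[of x y] by simp

lemma T_surj: "\<exists>x. T x = z"
proof -
  have isc: "isCont T x" for x using deriv_T by (rule DERIV_isCont)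
  define u where "u = \<bar>z - T 0\<bar> + 1"
  have u: "0 < u" "\<bar>z - T 0\<bar> < u" by (auto simp: u_def)
  have "\<exists>x. -u \<le> x \<and> x \<le> u \<and> T x = z"
  proof (rule IVT)
    show "T (-u) \<le> z" using T_expands_less[of "-u" 0] u by linarith
    show "z \<le> T u" using T_expands_less[of 0 u] u by linarith
  qed (auto simp: u_def isc)
  thus ?thesis by blast
qed

definition S :: "real \<Rightarrow> real" where "S = inv T"

lemma T_S [simp]: "T (S z) = z"
  unfolding S_def by (rule f_inv_into_f) (use T_surj in \<open>auto simp: image_iff, metis\<close>)

lemma S_eqI: "T y = z \<Longrightarrow> S z = y"
  by (rule T_inj) simp

lemma S_lipschitz: "\<bar>S x - S y\<bar> \<le> \<bar>x - y\<bar>"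
  using T_expands[of "S x" "S y"] by simp

lemma S_isCont: "isCont S x"
  unfolding continuous_at_eps_delta dist_real_def
  using S_lipschitz le_less_trans by blast

lemma T_shift: "T (x + of_int k) = T x + real d * of_int k"
proof (induction k rule: int_induct[where k = 0])
  case (step1 i)
  have "T (x + of_int i + 1) = T (x + of_int i) + d" by (rule degree)
  with step1 show ?case by (simp add: algebra_simps)
next
  case (step2 i)
  have "T (x + of_int (i - 1) + 1) = T (x + of_int (i - 1)) + d" by (rule degree)
  with step2 show ?case by (simp add: algebra_simps)
qed simp

lemma S_shift: "S (z + real d * of_int k) = S z + of_int k"
  by (rule S_eqI) (simp add: T_shift)

lemma deriv_S: "(S has_real_derivative inverse (T1 (S x))) (at x)"
  by (rule DERIV_inverse_function[where a = "x - 1" and b = "x + 1", OF deriv_T])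
    (auto simp: S_isCont T1_nz)

text \<open>
  The points \<open>x, x + 1, ..., x + d - 1\<close> are the lifts of one point of the circle to a period of \<open>S\<close>
  modulo \<open>1\<close>, so that \<open>S\<close> maps them to one representative of each preimage. The branches of the inverse are
  smooth in \<open>x\<close>, whereas the index set of \<^const>\<open>transfer\<close> jumps.
\<close>

lemma transfer_eq:
  assumes "periodic g"
  shows "transfer T g x = (\<Sum>k<d. g (S (x + real k)) / T1 (S (x + real k)))"
  unfolding transfer_def
proof (rule sum.reindex_bij_witness[where i = "\<lambda>k. frac (S (x + real k))"
      and j = "\<lambda>y. nat (\<lfloor>T y - x\<rfloor> mod int d)"], goal_cases)
  case (1 y)
  define n where "n = \<lfloor>T y - x\<rfloor>"
  have n: "T y = x + of_int n" using 1 by (auto simp: n_def elim: Ints_cases)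
  have "real (nat (n mod int d)) = of_int (n mod int d)" using d_pos by simp
  also have "\<dots> = of_int n + real d * of_int (- (n div int d))"
    by (simp add: minus_mult_div_eq_mod[symmetric])
  finally have "S (x + real (nat (n mod int d))) = S (T y + real d * of_int (- (n div int d)))"
    using n by (simp only: add.assoc)
  also have "\<dots> = y - of_int (n div int d)" unfolding S_shift by (simp add: S_eqI)
  also have "frac \<dots> = y" using 1 by (simp add: frac_unique_iff)
  finally show ?case by (simp add: n_def)
next
  case (2 y)
  show ?case using d_pos by (simp add: nat_less_iff)
next
  case (3 k)
  define m where "m = \<lfloor>S (x + real k)\<rfloor>"
  have fr: "frac (S (x + real k)) = S (x + real k) + of_int (- m)" by (simp add: frac_def m_def)
  have T: "T (frac (S (x + real k))) - x = of_int (int k + int d * (- m))"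
    unfolding fr T_shift by simp
  have "nat (\<lfloor>T (frac (S (x + real k))) - x\<rfloor> mod int d) = nat ((int k + int d * (- m)) mod int d)"
    unfolding T floor_of_int ..
  also have "(int k + int d * (- m)) mod int d = int k mod int d" by (rule mod_mult_self2)
  finally show ?case using 3 by simp
next
  case (4 k)
  define m where "m = \<lfloor>S (x + real k)\<rfloor>"
  have fr: "frac (S (x + real k)) = S (x + real k) + of_int (- m)" by (simp add: frac_def m_def)
  have T: "T (frac (S (x + real k))) - x = of_int (int k + int d * (- m))"
    unfolding fr T_shift by simp
  show ?case unfolding mem_Collect_eq T by (simp add: frac_lt_1)
next
  case (5 y)
  define n where "n = \<lfloor>T y - x\<rfloor>"
  have n: "T y = x + of_int n" using 5 by (auto simp: n_def elim: Ints_cases)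
  have "real (nat (n mod int d)) = of_int (n mod int d)" using d_pos by simp
  also have "\<dots> = of_int n + real d * of_int (- (n div int d))"
    by (simp add: minus_mult_div_eq_mod[symmetric])
  finally have "S (x + real (nat (n mod int d))) = S (T y + real d * of_int (- (n div int d)))"
    using n by (simp only: add.assoc)
  also have "\<dots> = y + of_int (- (n div int d))" unfolding S_shift by (simp add: S_eqI)
  finally show ?case
    using T1_pos[of y] by (simp only: n_def[symmetric] deriv_T_eq
      periodic_shift_int[OF assms] periodic_shift_int[OF T1_periodic] abs_of_pos)
qed

lemma transfer_deriv:
  assumes "periodic g" and g: "\<And>x. (g has_real_derivative g1 x) (at x)"
  shows "(transfer T g has_real_derivative
    transfer T (\<lambda>y. g1 y / T1 y - g y * T2 y / (T1 y)\<^sup>2) x) (at x)"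
proof -
  have "periodic g1" using g \<open>periodic g\<close> by (rule periodic_deriv)
  have p: "periodic (\<lambda>y. g1 y / T1 y - g y * T2 y / (T1 y)\<^sup>2)"
    using \<open>periodic g1\<close> \<open>periodic g\<close> T1_periodic T2_periodic by (simp add: periodic_def)
  have branch: "((\<lambda>x. g (S (x + real k)) / T1 (S (x + real k))) has_real_derivative
      (g1 (S (x + real k)) / T1 (S (x + real k)) -
       g (S (x + real k)) * T2 (S (x + real k)) / (T1 (S (x + real k)))\<^sup>2) / T1 (S (x + real k))) (at x)"
    for k
  proof -
    let ?y = "S (x + real k)"
    have S': "((\<lambda>x. S (x + real k)) has_real_derivative inverse (T1 ?y)) (at x)"
      using deriv_S[of "x + real k"] by (simp add: DERIV_shift)
    have "((\<lambda>x. g (S (x + real k))) has_real_derivative g1 ?y * inverse (T1 ?y)) (at x)"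
      by (rule DERIV_chain2[OF g S'])
    moreover have "((\<lambda>x. T1 (S (x + real k))) has_real_derivative T2 ?y * inverse (T1 ?y)) (at x)"
      by (rule DERIV_chain2[OF deriv_T1 S'])
    ultimately show ?thesis
      by (rule DERIV_cong[OF DERIV_divide]) (use T1_nz[of ?y] in \<open>simp_all add: field_simps power2_eq_square\<close>)
  qed
  show ?thesis
    unfolding transfer_eq[OF p] transfer_eq[OF \<open>periodic g\<close>, abs_def]
    by (intro DERIV_sum branch)
qed

lemma transfer_continuous:
  assumes "periodic g" "continuous_on UNIV g"
  shows "continuous_on UNIV (transfer T g)"
proof -
  have S: "continuous_on UNIV (\<lambda>x. S (x + real k))" for k
    by (rule continuous_on_compose2[of UNIV S])
      (auto intro!: continuous_intros continuous_at_imp_continuous_on S_isCont)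
  show ?thesis
    unfolding transfer_eq[OF assms(1), abs_def]
    by (intro continuous_on_sum continuous_on_divide continuous_on_compose2[OF assms(2) S]
        continuous_on_compose2[OF T1_cont S]) (auto simp: T1_nz)
qed

text \<open>
  If \<open>G\<close> is a primitive of \<open>g\<close>, then the sum of \<open>G\<close> over the branches of the inverse is a primitive of
  the transferred function. Its increment over \<open>[0, 1]\<close> telescopes to the increment of \<open>G\<close> from
  \<open>S 0\<close> to \<open>S 0 + 1\<close>.
\<close>

lemma transfer_integral:
  assumes "periodic g" "continuous_on UNIV g"
  shows "integral {0..1} (transfer T g) = integral {0..1} g"
proof -
  obtain G where G: "\<And>x. (G has_real_derivative g x) (at x)"
    using continuous_primitive[OF assms(2)] by blast
  define H where "H = (\<lambda>x. \<Sum>k<d. G (S (x + real k)))"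
  have H: "(H has_real_derivative transfer T g x) (at x)" for x
    unfolding H_def transfer_eq[OF assms(1)]
  proof (intro DERIV_sum)
    fix k
    have S': "((\<lambda>x. S (x + real k)) has_real_derivative inverse (T1 (S (x + real k)))) (at x)"
      using deriv_S[of "x + real k"] by (simp add: DERIV_shift)
    show "((\<lambda>x. G (S (x + real k))) has_real_derivative g (S (x + real k)) / T1 (S (x + real k))) (at x)"
      using DERIV_chain2[OF G S'] by (simp add: divide_inverse)
  qed
  have const: "G (x + 1) - G x = G (0 + 1) - G 0" for x
  proof (rule DERIV_isconst_all[where f = "\<lambda>x. G (x + 1) - G x"], rule allI)
    fix x
    have "((\<lambda>x. G (x + 1)) has_real_derivative g x) (at x)"
      using G[of "x + 1"] assms(1) by (simp add: DERIV_shift periodic_def)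
    from DERIV_diff[OF this G[of x]] show "((\<lambda>x. G (x + 1) - G x) has_real_derivative 0) (at x)"
      by simp
  qed
  have "integral {0..1} (transfer T g) = H 1 - H 0" by (rule integral_eq_primitive) (rule H)
  also have "\<dots> = (\<Sum>k<d. G (S (real (Suc k))) - G (S (real k)))"
    by (simp add: H_def sum_subtractf add.commute)
  also have "\<dots> = G (S (real d)) - G (S 0)"
    using sum_lessThan_telescope[of "\<lambda>k. G (S (real k))" d] by simp
  also have "S (real d) = S 0 + 1" using S_shift[of 0 1] by simp
  also have "G (S 0 + 1) - G (S 0) = G 1 - G 0" using const[of "S 0"] by simp
  also have "\<dots> = integral {0..1} g" by (rule integral_eq_primitive[symmetric]) (rule G)
  finally show ?thesis .
qed

text \<open>
  The crude factor \<open>d\<close> is good enough for a single application of the operator; the powers are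
  controlled by the cone.
\<close>

lemma transfer_bound:
  assumes "periodic g" "\<And>y. \<bar>g y\<bar> \<le> K"
  shows "\<bar>transfer T g x\<bar> \<le> real d * K"
proof -
  have "\<bar>transfer T g x\<bar> \<le> (\<Sum>k<d. \<bar>g (S (x + real k)) / T1 (S (x + real k))\<bar>)"
    unfolding transfer_eq[OF assms(1)] by (rule sum_abs)
  also have "\<dots> \<le> (\<Sum>k<d. K)"
  proof (rule sum_mono)
    fix k
    let ?y = "S (x + real k)"
    have "\<bar>g ?y / T1 ?y\<bar> = \<bar>g ?y\<bar> / T1 ?y" using T1_pos[of ?y] by (simp add: abs_divide)
    also have "\<dots> \<le> \<bar>g ?y\<bar> / 1" using T1_gt_1[of ?y] by (intro divide_left_mono) auto
    also have "\<dots> \<le> K" using assms(2) by simp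
    finally show "\<bar>g ?y / T1 ?y\<bar> \<le> K" .
  qed
  finally show ?thesis by simp
qed

lemma transfer_pow_periodic_continuous:
  assumes "periodic g" "continuous_on UNIV g"
  shows "periodic ((transfer T ^^ n) g) \<and> continuous_on UNIV ((transfer T ^^ n) g)"
  by (induction n) (use assms in \<open>auto intro: transfer_periodic transfer_continuous\<close>)

end

section \<open>Exponential decay\<close>

definition log_lipschitz_cone :: "real \<Rightarrow> (real \<Rightarrow> real) set" where
  "log_lipschitz_cone a = {g. periodic g \<and> (\<forall>x. 0 < g x) \<and>
     (\<forall>x. \<exists>g'. (g has_real_derivative g') (at x) \<and> \<bar>g'\<bar> \<le> a * g x)}"

lemma cone_continuous: "g \<in> log_lipschitz_cone a \<Longrightarrow> continuous_on UNIV g"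
  unfolding log_lipschitz_cone_def
  using DERIV_isCont by (blast intro: continuous_at_imp_continuous_on)

text \<open>
  The bound on \<open>g' / g\<close> says that \<open>g x * exp (a * x)\<close> increases and \<open>g x * exp (- a * x)\<close> decreases.
\<close>

lemma cone_harnack_le:
  assumes g: "g \<in> log_lipschitz_cone a" and "x \<le> y"
  shows "g x \<le> g y * exp (a * (y - x))" "g y \<le> g x * exp (a * (y - x))"
proof -
  have "g x * exp (a * x) \<le> g y * exp (a * y)"
  proof (rule DERIV_nonneg_imp_nondecreasing[OF \<open>x \<le> y\<close>])
    fix z
    obtain g' where g': "(g has_real_derivative g') (at z)" "\<bar>g'\<bar> \<le> a * g z"
      using g unfolding log_lipschitz_cone_def by blast
    have "((\<lambda>x. g x * exp (a * x)) has_real_derivative (g' + a * g z) * exp (a * z)) (at z)"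
      by (auto intro!: derivative_eq_intros g' simp: algebra_simps)
    moreover have "0 \<le> (g' + a * g z) * exp (a * z)" using g' by simp
    ultimately show "\<exists>d. ((\<lambda>x. g x * exp (a * x)) has_real_derivative d) (at z) \<and> 0 \<le> d" by blast
  qed
  from mult_right_mono[OF this, of "exp (- a * x)"] show "g x \<le> g y * exp (a * (y - x))"
    by (simp add: mult.assoc exp_add[symmetric] algebra_simps)
  have "g x * exp (- a * x) \<ge> g y * exp (- a * y)"
  proof (rule DERIV_nonpos_imp_nonincreasing[OF \<open>x \<le> y\<close>])
    fix z
    obtain g' where g': "(g has_real_derivative g') (at z)" "\<bar>g'\<bar> \<le> a * g z"
      using g unfolding log_lipschitz_cone_def by blast
    have "((\<lambda>x. g x * exp (- a * x)) has_real_derivative (g' - a * g z) * exp (- a * z)) (at z)"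
      by (auto intro!: derivative_eq_intros g' simp: algebra_simps)
    moreover have "(g' - a * g z) * exp (- a * z) \<le> 0"
      using g' by (simp add: mult_nonpos_nonneg)
    ultimately show "\<exists>d. ((\<lambda>x. g x * exp (- a * x)) has_real_derivative d) (at z) \<and> d \<le> 0" by blast
  qed
  from mult_right_mono[OF this, of "exp (a * y)"] show "g y \<le> g x * exp (a * (y - x))"
    by (simp add: mult.assoc exp_add[symmetric] algebra_simps)
qed

text \<open>
  Any two points of the circle have representatives at distance at most \<open>1\<close>, so the values of a
  member of the cone differ at most by the factor \<open>exp a\<close>, and its mean lies among them.
\<close>

lemma cone_mean:
  assumes g: "g \<in> log_lipschitz_cone a" and "0 \<le> a"
  shows "integral {0..1} g \<le> g x * exp a" "g x \<le> integral {0..1} g * exp a"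
proof -
  have pos: "\<And>x. 0 < g x" and per: "periodic g" using g by (auto simp: log_lipschitz_cone_def)
  define u where "u = frac x"
  have u: "u \<in> {0..1}" using frac_lt_1[of x] by (simp add: u_def)
  have gx: "g x = g u" by (simp add: u_def periodic_frac[OF per])
  have int: "g integrable_on {0..1}"
    using cone_continuous[OF g] by (intro integrable_continuous_real) (auto intro: continuous_on_subset)
  have *: "g v \<le> g w * exp a" if "v \<in> {0..1}" "w \<in> {0..1}" for v w
  proof (cases "v \<le> w")
    case True
    have "g v \<le> g w * exp (a * (w - v))" by (rule cone_harnack_le[OF g True])
    also have "\<dots> \<le> g w * exp (a * 1)" using pos[of w] that \<open>0 \<le> a\<close>
      by (intro mult_left_mono) (auto intro!: mult_left_le)
    finally show ?thesis by simp
  next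
    case False
    hence "w \<le> v" by simp
    have "g v \<le> g w * exp (a * (v - w))" by (rule cone_harnack_le[OF g \<open>w \<le> v\<close>])
    also have "\<dots> \<le> g w * exp (a * 1)" using pos[of w] that \<open>0 \<le> a\<close>
      by (intro mult_left_mono) (auto intro!: mult_left_le)
    finally show ?thesis by simp
  qed
  have "integral {0..1} g \<le> integral {0..1} (\<lambda>_::real. g u * exp a)"
    by (rule integral_le[OF int]) (use * u in auto)
  thus "integral {0..1} g \<le> g x * exp a" by (simp add: gx)
  have "integral {0..1} (\<lambda>_::real. g u * exp (-a)) \<le> integral {0..1} g"
  proof (rule integral_le[OF _ int])
    fix v :: real assume "v \<in> {0..1}"
    from mult_right_mono[OF *[OF u this], of "exp (-a)"] show "g u * exp (- a) \<le> g v"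
      by (simp add: mult.assoc exp_add[symmetric])
  qed (rule integrable_const_ivl)
  hence "g u * exp (-a) \<le> integral {0..1} g" by simp
  from mult_right_mono[OF this, of "exp a"] show "g x \<le> integral {0..1} g * exp a"
    by (simp add: gx mult.assoc exp_add[symmetric])
qed

text \<open>
  The transfer operator turns a bound \<open>\<bar>g'\<bar> \<le> a * g\<close> into one with \<open>a / l + D\<close> in place of \<open>a\<close>.
  The aperture is so large that this is at most \<open>cone_ratio l * a\<close>, where \<open>cone_ratio l\<close> is the
  midpoint between the contraction \<open>1 / l\<close> and \<open>1\<close>. The coupling mass is the fraction of the mean
  that can be subtracted from a transferred function within the cone.
\<close>

definition cone_ratio :: "real \<Rightarrow> real" where
  "cone_ratio l = (1 + 1 / l) / 2"

definition cone_aperture :: "real \<Rightarrow> real \<Rightarrow> real" where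
  "cone_aperture l D = (D + 1) / (cone_ratio l - 1 / l)"

definition coupling_mass :: "real \<Rightarrow> real \<Rightarrow> real" where
  "coupling_mass l D = (1 - cone_ratio l) * exp (- cone_aperture l D)"

context expanding_lift
begin

abbreviation "\<sigma> \<equiv> cone_ratio l"
abbreviation "a \<equiv> cone_aperture l D"
abbreviation "c \<equiv> coupling_mass l D"

lemma ratio: "1 / l < \<sigma>" "\<sigma> < 1" "0 < \<sigma>"
  using l_gt_1 by (auto simp: cone_ratio_def field_simps)

text \<open>
  The summand \<open>1\<close> in the aperture ensures \<open>1 \<le> a\<close>, also when \<open>D\<close> is \<open>0\<close>.
\<close>

lemma aperture: "1 \<le> a" "a / l + D \<le> \<sigma> * a"
proof -
  have s: "0 < \<sigma> - 1 / l" "\<sigma> - 1 / l \<le> 1"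
    using ratio l_gt_1 zero_less_divide_1_iff[of l] by linarith+
  have e: "(\<sigma> - 1 / l) * a = D + 1" using s by (simp add: cone_aperture_def)
  show "1 \<le> a" unfolding cone_aperture_def using s D_nonneg by (simp add: le_divide_eq)
  show "a / l + D \<le> \<sigma> * a" using e by (simp add: algebra_simps)
qed

lemma coupling: "0 < c" "c < 1"
proof -
  show "0 < c" using ratio by (simp add: coupling_mass_def)
  have "(1 - \<sigma>) * exp (- a) \<le> (1 - \<sigma>) * 1" using ratio aperture(1) by (intro mult_left_mono) auto
  thus "c < 1" using ratio by (simp only: coupling_mass_def mult_1_right)
qed

lemma transfer_pos:
  assumes "periodic g" "\<And>x. 0 < g x" shows "0 < transfer T g x"
  unfolding transfer_eq[OF assms(1)] using d_pos by (intro sum_pos divide_pos_pos assms(2) T1_pos) auto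

text \<open>
  In the derivative of the transferred function, \<open>g'\<close> comes with the factor \<open>1 / T1 \<le> 1 / l\<close>, and the
  distortion term is at most \<open>D * g\<close>. Comparing inside the operator, which is positive, turns the
  bound into a multiple of the transferred function itself.
\<close>

lemma transfer_cone:
  assumes g: "g \<in> log_lipschitz_cone a"
  shows "transfer T g \<in> log_lipschitz_cone (\<sigma> * a)"
proof -
  have per: "periodic g" and pos: "\<And>x. 0 < g x" using g by (auto simp: log_lipschitz_cone_def)
  have "\<forall>x. \<exists>g'. (g has_real_derivative g') (at x) \<and> \<bar>g'\<bar> \<le> a * g x"
    using g by (auto simp: log_lipschitz_cone_def)
  then obtain g1 where g1: "\<And>x. (g has_real_derivative g1 x) (at x)" "\<And>x. \<bar>g1 x\<bar> \<le> a * g x"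
    by metis
  have "\<bar>transfer T (\<lambda>y. g1 y / T1 y - g y * T2 y / (T1 y)\<^sup>2) x\<bar> \<le> (\<sigma> * a) * transfer T g x" for x
    unfolding transfer_cmult[symmetric]
  proof (rule transfer_abs_le)
    fix y
    have "\<bar>g1 y / T1 y - g y * T2 y / (T1 y)\<^sup>2\<bar> \<le> \<bar>g1 y\<bar> / T1 y + g y * \<bar>T2 y\<bar> / (T1 y)\<^sup>2"
      using abs_triangle_ineq4[of "g1 y / T1 y" "g y * T2 y / (T1 y)\<^sup>2"] T1_pos[of y] pos[of y]
      by (simp add: abs_divide abs_mult)
    also have "\<bar>g1 y\<bar> / T1 y \<le> (a * g y) / l"
      using g1(2)[of y] T1_ge[of y] l_gt_1 by (intro frac_le) auto
    also have "g y * \<bar>T2 y\<bar> / (T1 y)\<^sup>2 \<le> (g y * D) / 1"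
      using T2_le[of y] T1_gt_1[of y] pos[of y] D_nonneg
      by (intro frac_le mult_left_mono) (auto intro: one_le_power mult_nonneg_nonneg)
    also have "a * g y / l + g y * D / 1 = (a / l + D) * g y" by (simp add: algebra_simps)
    also have "\<dots> \<le> (\<sigma> * a) * g y" using aperture(2) pos[of y] by (intro mult_right_mono) auto
    finally show "\<bar>g1 y / T1 y - g y * T2 y / (T1 y)\<^sup>2\<bar> \<le> \<sigma> * a * g y" by simp
  qed
  thus ?thesis
    unfolding log_lipschitz_cone_def
    using transfer_periodic transfer_pos[OF per pos] transfer_deriv[OF per g1(1)] by blast
qed

text \<open>
  Subtracting a constant leaves the derivative unchanged, so it is enough that
  \<open>\<sigma> * transfer T g \<le> transfer T g - c * m\<close>. The lower bound of a cone member by its mean gives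
  this for the chosen \<open>c\<close>.
\<close>

lemma transfer_minus_mass_cone:
  assumes g: "g \<in> log_lipschitz_cone a"
  defines "m \<equiv> integral {0..1} g"
  defines "h \<equiv> \<lambda>x. transfer T g x - c * m"
  shows "h \<in> log_lipschitz_cone a" "integral {0..1} h = (1 - c) * m"
proof -
  note Lg = transfer_cone[OF g]
  have gc: "periodic g" "continuous_on UNIV g"
    using g cone_continuous by (auto simp: log_lipschitz_cone_def)
  have int: "integral {0..1} (transfer T g) = m"
    unfolding m_def by (rule transfer_integral[OF gc])
  have Lpos: "0 < transfer T g x" for x using Lg by (simp add: log_lipschitz_cone_def)
  have cm: "c * m \<le> (1 - \<sigma>) * transfer T g x" for x
  proof -
    have "m \<le> transfer T g x * exp (\<sigma> * a)"
      using cone_mean(1)[OF Lg, of x] int ratio aperture by simp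
    also have "\<dots> \<le> transfer T g x * exp a"
      using Lpos[of x] ratio aperture(1) by (intro mult_left_mono) auto
    finally have "(1 - \<sigma>) * exp (- a) * m \<le> (1 - \<sigma>) * exp (- a) * (transfer T g x * exp a)"
      using ratio by (intro mult_left_mono) auto
    also have "\<dots> = (1 - \<sigma>) * transfer T g x" by (simp add: exp_minus field_simps)
    finally show ?thesis by (simp add: coupling_mass_def)
  qed
  have hpos: "\<sigma> * transfer T g x \<le> h x" for x
    using cm[of x] by (simp add: h_def algebra_simps)
  show "h \<in> log_lipschitz_cone a"
    unfolding log_lipschitz_cone_def
  proof (intro CollectI conjI allI)
    show "periodic h" using transfer_periodic[of T g] by (simp add: h_def periodic_def)
    fix x
    show "0 < h x" using hpos[of x] Lpos[of x] ratio by (meson less_le_trans mult_pos_pos)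
    obtain g' where g': "(transfer T g has_real_derivative g') (at x)" "\<bar>g'\<bar> \<le> \<sigma> * a * transfer T g x"
      using Lg unfolding log_lipschitz_cone_def by blast
    have "(h has_real_derivative g') (at x)"
      unfolding h_def by (auto intro!: derivative_eq_intros g')
    moreover have "\<bar>g'\<bar> \<le> a * h x"
    proof -
      have "\<sigma> * a * transfer T g x = a * (\<sigma> * transfer T g x)" by simp
      also have "\<dots> \<le> a * h x" using hpos[of x] aperture(1) by (intro mult_left_mono) auto
      finally show ?thesis using g'(2) by simp
    qed
    ultimately show "\<exists>g'. (h has_real_derivative g') (at x) \<and> \<bar>g'\<bar> \<le> a * h x" by blast
  qed
  have "transfer T g integrable_on {0..1}"
    using transfer_continuous[OF gc] by (intro integrable_continuous_real) (auto intro: continuous_on_subset)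
  thus "integral {0..1} h = (1 - c) * m"
    unfolding h_def by (subst integral_diff) (auto simp: int algebra_simps)
qed

text \<open>
  In each step the constant \<open>c * m\<close> is taken from both images. It cancels in the difference, and what is
  left are again members of the cone, with mean \<open>(1 - c) * m\<close>.
\<close>

lemma cone_coupling:
  assumes "g \<in> log_lipschitz_cone a" "h \<in> log_lipschitz_cone a"
    and "integral {0..1} g = integral {0..1} h"
  shows "\<bar>(transfer T ^^ n) g x - (transfer T ^^ n) h x\<bar> \<le> (1 - c) ^ n * exp a * integral {0..1} g"
  using assms
proof (induction n arbitrary: g h)
  case 0
  have "0 < g x" "0 < h x" using 0 by (auto simp: log_lipschitz_cone_def)
  moreover have "g x \<le> integral {0..1} g * exp a" "h x \<le> integral {0..1} g * exp a"
    using cone_mean(2)[OF 0(1), of x] cone_mean(2)[OF 0(2), of x] 0(3) aperture(1) by auto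
  ultimately show ?case by (auto simp: abs_le_iff mult.commute)
next
  case (Suc n)
  define m where "m = integral {0..1} g"
  define g2 where "g2 = (\<lambda>x. transfer T g x - c * m)"
  define h2 where "h2 = (\<lambda>x. transfer T h x - c * m)"
  have g2: "g2 \<in> log_lipschitz_cone a" "integral {0..1} g2 = (1 - c) * m"
    using transfer_minus_mass_cone[OF Suc.prems(1)] by (auto simp: g2_def m_def)
  have h2: "h2 \<in> log_lipschitz_cone a" "integral {0..1} h2 = (1 - c) * m"
    using transfer_minus_mass_cone[OF Suc.prems(2)] Suc.prems(3) by (auto simp: h2_def m_def)
  have "(transfer T ^^ Suc n) g x - (transfer T ^^ Suc n) h x
      = (transfer T ^^ n) (transfer T g) x - (transfer T ^^ n) (transfer T h) x"
    by (simp only: funpow_Suc_right o_apply)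
  also have "\<dots> = (transfer T ^^ n) (\<lambda>y. g2 y - h2 y) x"
    using transfer_pow_diff[where f = "transfer T g" and g = "transfer T h" and n = n and T = T]
    by (simp add: g2_def h2_def)
  also have "\<dots> = (transfer T ^^ n) g2 x - (transfer T ^^ n) h2 x"
    by (simp add: transfer_pow_diff)
  also have "\<bar>\<dots>\<bar> \<le> (1 - c) ^ n * exp a * integral {0..1} g2"
    using g2 h2 by (intro Suc.IH) auto
  finally show ?case by (simp add: g2 m_def mult_ac)
qed

text \<open>
  Adding the constant \<open>2 * K\<close> makes the function at least \<open>K\<close>, hence at least its own derivative in
  absolute value; as \<open>1 \<le> a\<close>, it is then in the cone. It is compared with the constant function of the
  same mean.
\<close>

lemma zero_average_decay:
  assumes per: "periodic g" and g: "\<And>x. (g has_real_derivative g1 x) (at x)"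
    and K: "0 < K" "\<And>x. \<bar>g x\<bar> \<le> K" "\<And>x. \<bar>g1 x\<bar> \<le> K"
    and zero: "integral {0..1} g = 0"
  shows "\<bar>(transfer T ^^ n) g x\<bar> \<le> 2 * exp a * K * (1 - c) ^ n"
proof -
  define u where "u = (\<lambda>x. g x + 2 * K)"
  define v where "v = (\<lambda>x::real. 2 * K)"
  have K_le: "K \<le> u x" for x using K(2)[of x] by (auto simp: u_def abs_le_iff)
  have u: "u \<in> log_lipschitz_cone a"
    unfolding log_lipschitz_cone_def
  proof (intro CollectI conjI allI)
    show "periodic u" using per by (simp add: u_def periodic_def)
    fix x
    show "0 < u x" using K_le[of x] K(1) by simp
    have "(u has_real_derivative g1 x) (at x)"
      unfolding u_def by (auto intro!: derivative_eq_intros g)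
    moreover have "\<bar>g1 x\<bar> \<le> a * u x"
      using K(3)[of x] mult_mono[OF aperture(1) K_le[of x]] aperture(1) K(1) by simp
    ultimately show "\<exists>g'. (u has_real_derivative g') (at x) \<and> \<bar>g'\<bar> \<le> a * u x" by blast
  qed
  have v: "v \<in> log_lipschitz_cone a"
    using K(1) aperture(1)
    by (auto simp: log_lipschitz_cone_def v_def periodic_def intro!: exI[of _ 0])
  have "continuous_on UNIV g" by (rule DERIV_continuous_on) (rule has_field_derivative_at_within[OF g])
  hence "g integrable_on {0..1}"
    by (intro integrable_continuous_real) (auto intro: continuous_on_subset)
  hence iu: "integral {0..1} u = 2 * K" unfolding u_def by (subst integral_add) (auto simp: zero)
  have iv: "integral {0..1} v = 2 * K" by (simp add: v_def)
  have "(transfer T ^^ n) g x = (transfer T ^^ n) (\<lambda>y. u y - v y) x" by (simp add: u_def v_def)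
  also have "\<dots> = (transfer T ^^ n) u x - (transfer T ^^ n) v x" by (simp add: transfer_pow_diff)
  also have "\<bar>\<dots>\<bar> \<le> (1 - c) ^ n * exp a * integral {0..1} u"
    using u v iu iv by (intro cone_coupling) auto
  finally show ?thesis by (simp add: iu mult_ac)
qed

end

section \<open>Dependence of the transfer operator on the map\<close>

context expanding_lift
begin

text \<open>
  A map that is \<open>C\<^sup>1\<close>-close to \<open>T\<close> has inverse branches close to those of \<open>T\<close>, because \<open>T\<close> expands
  distances. The number \<open>r\<close> may depend on \<open>T\<close> and \<open>p\<close> but neither on the point \<open>x\<close> nor on the second
  derivative of the other map. This uniformity matters where the other map is chosen by a mean value theorem
  that depends on \<open>x\<close>.
\<close>

lemma transfer_stable:
  assumes p: "periodic p" "continuous_on UNIV p" and "0 < e"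
  obtains r where "0 < r"
    "\<And>T' T1' T2' l' D' p' x. expanding_lift T' T1' T2' d l' D' \<Longrightarrow> periodic p' \<Longrightarrow>
       (\<And>y. \<bar>T' y - T y\<bar> \<le> r) \<Longrightarrow> (\<And>y. \<bar>T1' y - T1 y\<bar> \<le> r) \<Longrightarrow> (\<And>y. \<bar>p' y - p y\<bar> \<le> r) \<Longrightarrow>
       \<bar>transfer T' p' x - transfer T p x\<bar> \<le> e"
proof -
  define q where "q = (\<lambda>y. p y / T1 y)"
  have q: "periodic q" "continuous_on UNIV q"
    using p T1_periodic T1_cont T1_nz by (auto simp: q_def periodic_def intro!: continuous_intros)
  have dp: "0 < real d" using d_pos by simp
  obtain P where P: "P > 0" "\<And>x. \<bar>p x\<bar> \<le> P" using periodic_continuous_bound[OF p] by blast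
  have "0 < e / (2 * d)" using \<open>0 < e\<close> dp by simp
  then obtain r1 where r1: "r1 > 0" "\<And>x y. \<bar>x - y\<bar> \<le> r1 \<Longrightarrow> \<bar>q x - q y\<bar> \<le> e / (2 * d)"
    using periodic_uniformly_continuous[OF q] by metis
  define r where "r = min r1 (e / (2 * d * (1 + P)))"
  show thesis
  proof (rule that[of r])
    show "0 < r" using r1 \<open>0 < e\<close> P(1) dp by (simp add: r_def)
    fix T' T1' T2' l' D' p' x
    assume "expanding_lift T' T1' T2' d l' D'" and p': "periodic p'"
      and close: "\<And>y. \<bar>T' y - T y\<bar> \<le> r" "\<And>y. \<bar>T1' y - T1 y\<bar> \<le> r" "\<And>y. \<bar>p' y - p y\<bar> \<le> r"
    then interpret T': expanding_lift T' T1' T2' d l' D' by simp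
    \<comment> \<open>One half of the error is due to the weights at the same point \<open>y\<close>, the other to
        replacing \<open>y\<close> by \<open>y0\<close> in the fixed function \<open>q\<close>.\<close>
    have branch: "\<bar>p' (T'.S z) / T1' (T'.S z) - p (S z) / T1 (S z)\<bar> \<le> e / d" for z
    proof -
      define y y0 where "y = T'.S z" and "y0 = S z"
      have "\<bar>y - y0\<bar> \<le> \<bar>T y - T y0\<bar>" by (rule T_expands)
      also have "T y0 = T' y" by (simp add: y_def y0_def)
      also have "\<bar>T y - T' y\<bar> \<le> r" using close(1)[of y] by simp
      finally have "\<bar>q y - q y0\<bar> \<le> e / (2 * d)" by (intro r1(2)) (simp add: r_def)
      moreover have "\<bar>p' y / T1' y - q y\<bar> \<le> e / (2 * d)"
      proof -
        have g: "1 < T1' y" "1 < T1 y" by (rule T'.T1_gt_1, rule T1_gt_1)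
        have "p' y / T1' y - q y = (p' y - p y) / T1' y + p y * (T1 y - T1' y) / (T1 y * T1' y)"
          using g by (simp add: q_def field_simps)
        also have "\<bar>\<dots>\<bar> \<le> \<bar>p' y - p y\<bar> / T1' y + \<bar>p y\<bar> * \<bar>T1 y - T1' y\<bar> / (T1 y * T1' y)"
          using abs_triangle_ineq[of "(p' y - p y) / T1' y" "p y * (T1 y - T1' y) / (T1 y * T1' y)"] g
          by (simp add: abs_mult abs_divide)
        also have "\<bar>p' y - p y\<bar> / T1' y \<le> r / 1" using close(3)[of y] g by (intro frac_le) auto
        also have "\<bar>p y\<bar> * \<bar>T1 y - T1' y\<bar> / (T1 y * T1' y) \<le> P * r / 1"
        proof (intro frac_le mult_mono)
          show "1 \<le> T1 y * T1' y" using g mult_mono[of 1 "T1 y" 1 "T1' y"] by simp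
        qed (use P close(2)[of y] in \<open>auto simp: abs_minus_commute less_imp_le\<close>)
        also have "r / 1 + P * r / 1 = r * (1 + P)" by (simp add: algebra_simps)
        also have "\<dots> \<le> e / (2 * d * (1 + P)) * (1 + P)" using P(1) by (intro mult_right_mono) (auto simp: r_def)
        also have "\<dots> = e / (2 * d)" using P(1) by simp
        finally show ?thesis by simp
      qed
      ultimately have "\<bar>p' y / T1' y - q y0\<bar> \<le> e / (2 * d) + e / (2 * d)" by linarith
      also have "\<dots> = e / d" by simp
      finally show ?thesis by (simp add: q_def y_def y0_def)
    qed
    have "\<bar>transfer T' p' x - transfer T p x\<bar> =
      \<bar>\<Sum>k<d. p' (T'.S (x + real k)) / T1' (T'.S (x + real k)) - p (S (x + real k)) / T1 (S (x + real k))\<bar>"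
      unfolding transfer_eq[OF p(1)] T'.transfer_eq[OF p'] by (simp add: sum_subtractf)
    also have "\<dots> \<le> (\<Sum>k<d. e / d)" by (rule order_trans[OF sum_abs sum_mono]) (rule branch)
    also have "\<dots> = e" using dp by simp
    finally show "\<bar>transfer T' p' x - transfer T p x\<bar> \<le> e" .
  qed
qed

end

text \<open>
  Each branch \<open>Y s z\<close> of the inverse of \<open>T + s * U\<close> moves with velocity \<open>- U / (T1 + s * U1)\<close>. Differentiating
  \<open>w / (T1 + s * U1)\<close> along it and factoring out the weight \<open>1 / (T1 + s * U1)\<close> gives the
  integrand on the right.
\<close>

lemma transfer_segment_mvt:
  fixes T T1 T2 U U1 U2 w w1 :: "real \<Rightarrow> real"
  defines "Ts \<equiv> \<lambda>s y. T y + s * U y" and "T1s \<equiv> \<lambda>s y. T1 y + s * U1 y" and "T2s \<equiv> \<lambda>s y. T2 y + s * U2 y"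
  assumes lift: "\<And>s. s \<in> {0..1} \<Longrightarrow> expanding_lift (Ts s) (T1s s) (T2s s) d l D"
    and T: "\<And>x. (T has_real_derivative T1 x) (at x)" "\<And>x. (T1 has_real_derivative T2 x) (at x)"
    and U: "\<And>x. (U has_real_derivative U1 x) (at x)" "\<And>x. (U1 has_real_derivative U2 x) (at x)"
    and "periodic U"
    and w: "periodic w" "\<And>x. (w has_real_derivative w1 x) (at x)"
  shows "\<exists>s\<in>{0..1}. transfer (Ts 1) w x - transfer (Ts 0) w x =
    transfer (Ts s) (\<lambda>y. - (w y * U1 y / T1s s y) - U y * w1 y / T1s s y
      + U y * T2s s y / (T1s s y)\<^sup>2 * w y) x"
proof -
  define Y where "Y = (\<lambda>s z. expanding_lift.S (Ts s) z)"
  define br where "br = (\<lambda>s z. w (Y s z) / T1s s (Y s z))"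
  define q where "q = (\<lambda>s y. - (w y * U1 y / T1s s y) - U y * w1 y / T1s s y
      + U y * T2s s y / (T1s s y)\<^sup>2 * w y)"
  have Ucont: "continuous_on UNIV U"
    by (rule DERIV_continuous_on) (rule has_field_derivative_at_within[OF U(1)])
  obtain K where K: "K > 0" "\<And>y. \<bar>U y\<bar> \<le> K" using periodic_continuous_bound[OF \<open>periodic U\<close> Ucont] by blast
  have "periodic w1" "periodic U1" using periodic_deriv[of w] periodic_deriv[of U] w U \<open>periodic U\<close> by auto
  have Y': "((\<lambda>s. Y s z) has_real_derivative - U (Y s z) / T1s s (Y s z)) (at s within {0..1})"
    if s: "s \<in> {0..1}" for s z
  proof -
    interpret L: expanding_lift "Ts s" "T1s s" "T2s s" d l D using s by (rule lift)
    \<comment> \<open>This expresses the branch at parameter \<open>t\<close> through the inverse at the fixed parameter \<open>s\<close>.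
        It replaces the implicit function theorem: the argument of that inverse is differentiable
        at \<open>t = s\<close> as soon as \<open>Y\<close> is continuous there.\<close>
    have shift: "Ts s (Y t z) = z - (t - s) * U (Y t z)" if t: "t \<in> {0..1}" for t
    proof -
      interpret Lt: expanding_lift "Ts t" "T1s t" "T2s t" d l D using t by (rule lift)
      have "Ts t (Y t z) = z" by (simp add: Y_def)
      thus ?thesis by (simp add: Ts_def algebra_simps)
    qed
    have lip: "\<bar>Y t z - Y s z\<bar> \<le> K * \<bar>t - s\<bar>" if t: "t \<in> {0..1}" for t
    proof -
      have "\<bar>Y t z - Y s z\<bar> \<le> \<bar>Ts s (Y t z) - Ts s (Y s z)\<bar>" by (rule L.T_expands)
      also have "\<dots> = \<bar>t - s\<bar> * \<bar>U (Y t z)\<bar>" using shift[OF t] shift[OF s] by (simp add: abs_mult)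
      also have "\<dots> \<le> \<bar>t - s\<bar> * K" by (intro mult_left_mono K) simp
      finally show ?thesis by (simp add: mult.commute)
    qed
    have "((\<lambda>t. Y t z - Y s z) \<longlongrightarrow> 0) (at s within {0..1})"
    proof (rule Lim_transform_bound)
      show "\<forall>\<^sub>F t in at s within {0..1}. norm (Y t z - Y s z) \<le> norm (K * \<bar>t - s\<bar>)"
        unfolding eventually_at_filter
        by (rule always_eventually) (use lip K(1) in \<open>auto simp: abs_mult\<close>)
      have "((\<lambda>t. K * \<bar>t - s\<bar>) \<longlongrightarrow> K * \<bar>s - s\<bar>) (at s within {0..1})" by (intro tendsto_intros)
      thus "((\<lambda>t. K * \<bar>t - s\<bar>) \<longlongrightarrow> 0) (at s within {0..1})" by simp
    qed
    hence Yc: "continuous (at s within {0..1}) (\<lambda>t. Y t z)" by (simp add: continuous_within LIM_zero_iff)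
    have "continuous (at s within {0..1}) (\<lambda>t. - U (Y t z))"
      by (intro continuous_minus continuous_within_compose3[OF _ Yc] DERIV_isCont[OF U(1)])
    hence "((\<lambda>t. z - (t - s) * U (Y t z)) has_real_derivative - U (Y s z)) (at s within {0..1})"
      unfolding DERIV_caratheodory_within by (intro exI[of _ "\<lambda>t. - U (Y t z)"]) (auto simp: algebra_simps)
    moreover have "(L.S has_real_derivative inverse (T1s s (Y s z))) (at (z - (s - s) * U (Y s z)))"
      using L.deriv_S[of z] by (simp add: Y_def)
    ultimately have "((\<lambda>t. L.S (z - (t - s) * U (Y t z))) has_real_derivative
        inverse (T1s s (Y s z)) * - U (Y s z)) (at s within {0..1})"
      by (rule DERIV_chain2[rotated])
    hence "((\<lambda>t. Y t z) has_real_derivative inverse (T1s s (Y s z)) * - U (Y s z)) (at s within {0..1})"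
    proof (rule has_field_derivative_transform_within[where d = 1])
      show "L.S (z - (t - s) * U (Y t z)) = Y t z" if "t \<in> {0..1}" for t
        using shift[OF that] by (rule L.S_eqI)
    qed (use s in auto)
    thus ?thesis by (simp add: divide_inverse mult.commute)
  qed
  have br': "((\<lambda>s. br s z) has_real_derivative q s (Y s z) / T1s s (Y s z)) (at s within {0..1})"
    if s: "s \<in> {0..1}" for s z
  proof -
    interpret L: expanding_lift "Ts s" "T1s s" "T2s s" d l D using s by (rule lift)
    note nz = L.T1_nz[of "Y s z"]
    note D = DERIV_chain2[OF _ Y'[OF s, of z]]
    have "((\<lambda>s. T1 (Y s z) + s * U1 (Y s z)) has_real_derivative
      (T2 (Y s z) * (- U (Y s z) / T1s s (Y s z)) +
        (1 * U1 (Y s z) + U2 (Y s z) * (- U (Y s z) / T1s s (Y s z)) * s))) (at s within {0..1})"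
      by (intro DERIV_add DERIV_mult D DERIV_ident T(2) U(2))
    moreover have "(\<lambda>s. T1 (Y s z) + s * U1 (Y s z)) = (\<lambda>s. T1s s (Y s z))" by (simp add: T1s_def)
    ultimately have T1s': "((\<lambda>s. T1s s (Y s z)) has_real_derivative
      (T2 (Y s z) * (- U (Y s z) / T1s s (Y s z)) +
        (1 * U1 (Y s z) + U2 (Y s z) * (- U (Y s z) / T1s s (Y s z)) * s))) (at s within {0..1})"
      by simp
    from DERIV_divide[OF D[OF w(2)] T1s' nz] show ?thesis
      unfolding br_def
      by (rule DERIV_cong) (use nz in \<open>simp add: q_def T2s_def field_simps power2_eq_square\<close>)
  qed
  have tr: "transfer (Ts s) w x = (\<Sum>k<d. br s (x + real k))"
    "transfer (Ts s) (q s) x = (\<Sum>k<d. q s (Y s (x + real k)) / T1s s (Y s (x + real k)))"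
    if s: "s \<in> {0..1}" for s
  proof -
    interpret L: expanding_lift "Ts s" "T1s s" "T2s s" d l D using s by (rule lift)
    have "periodic (q s)"
      using w(1) \<open>periodic w1\<close> \<open>periodic U\<close> \<open>periodic U1\<close> L.T1_periodic L.T2_periodic
      by (simp add: q_def periodic_def)
    thus "transfer (Ts s) (q s) x = (\<Sum>k<d. q s (Y s (x + real k)) / T1s s (Y s (x + real k)))"
      unfolding Y_def by (rule L.transfer_eq)
    show "transfer (Ts s) w x = (\<Sum>k<d. br s (x + real k))"
      unfolding Y_def br_def by (rule L.transfer_eq[OF w(1)])
  qed
  have "((\<lambda>s. transfer (Ts s) w x) has_real_derivative transfer (Ts s) (q s) x) (at s within {0..1})"
    if s: "s \<in> {0..1}" for s
  proof (rule has_field_derivative_transform_within[where d = 1])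
    show "((\<lambda>s. \<Sum>k<d. br s (x + real k)) has_real_derivative transfer (Ts s) (q s) x) (at s within {0..1})"
      unfolding tr(2)[OF s] by (intro DERIV_sum br' s)
  qed (use s tr in auto)
  hence "\<exists>s\<in>{0<..<1}. transfer (Ts 1) w x - transfer (Ts 0) w x = transfer (Ts s) (q s) x * (1 - 0)"
    by (intro mvt_simple[where f' = "\<lambda>s h. transfer (Ts s) (q s) x * h"])
      (auto simp: has_field_derivative_def)
  thus ?thesis unfolding q_def by force
qed

section \<open>Integration over the circle\<close>

lemma circle_integral:
  fixes f :: "real \<Rightarrow> real"
  assumes "continuous_on UNIV f"
  shows "integrable circle_measure f" "(\<integral>x. f x \<partial>circle_measure) = integral {0..1} f"
proof -
  have "set_integrable lborel {0..1} f"
    using assms by (intro borel_integrable_atLeastAtMost') (auto intro: continuous_on_subset)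
  hence S: "set_integrable lborel {0..<1} f" by (rule set_integrable_subset) auto
  thus "integrable circle_measure f"
    unfolding circle_measure_def set_integrable_def by (subst integrable_restrict_space) auto
  have "(\<integral>x. f x \<partial>circle_measure) = (LINT x:{0..<1}|lborel. f x)"
    unfolding circle_measure_def set_lebesgue_integral_def by (rule integral_restrict_space) auto
  also have "\<dots> = integral {0..<1} f" by (rule set_borel_integral_eq_integral(2)[OF S])
  also have "\<dots> = integral {0..1} f"
    by (rule integral_subset_negligible) (auto intro: negligible_subset[of "{1}"])
  finally show "(\<integral>x. f x \<partial>circle_measure) = integral {0..1} f" .
qed

lemma borel_circle: "f \<in> borel_measurable borel \<Longrightarrow> f \<in> borel_measurable circle_measure"
  unfolding circle_measure_def by (intro measurable_restrict_space1) simp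

lemma frac_circle_measurable:
  fixes T :: "real \<Rightarrow> real"
  assumes "continuous_on UNIV T"
  shows "(\<lambda>x. frac (T x)) \<in> measurable circle_measure circle_measure"
proof -
  have [measurable]: "T \<in> borel_measurable borel" using assms by (rule borel_measurable_continuous_onI)
  have "(\<lambda>x. frac (T x)) \<in> borel_measurable circle_measure"
    unfolding frac_def by (rule borel_circle) measurable
  thus ?thesis
    unfolding circle_measure_def by (intro measurable_restrict_space2) (auto simp: frac_lt_1)
qed

text \<open>
  The integral over the circle only sees \<open>T\<close> modulo \<open>1\<close>; by periodicity of \<open>\<phi>\<close> the fractional part
  can be dropped.
\<close>

lemma invariant_integral:
  fixes T f \<phi> :: "real \<Rightarrow> real"
  assumes inv: "invariant_probability_density T f"
    and cont: "continuous_on UNIV T" "continuous_on UNIV f" "continuous_on UNIV \<phi>" and per: "periodic \<phi>"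
  shows "integral {0..1} (\<lambda>x. \<phi> (T x) * f x) = integral {0..1} (\<lambda>x. \<phi> x * f x)"
proof -
  let ?M = "density circle_measure (\<lambda>x. ennreal (f x))"
  have f0: "\<And>x. 0 \<le> f x" and dis: "distr ?M circle_measure (\<lambda>x. frac (T x)) = ?M"
    using inv by (auto simp: invariant_probability_density_def)
  have meas: "g \<in> borel_measurable circle_measure" if "continuous_on UNIV g" for g :: "real \<Rightarrow> real"
    using that by (intro borel_circle borel_measurable_continuous_onI)
  have comp: "continuous_on UNIV (\<lambda>x. \<phi> (T x))"
    by (rule continuous_on_compose2[OF cont(3,1)]) auto
  have "integral {0..1} (\<lambda>x. \<phi> x * f x) = (\<integral>x. \<phi> x * f x \<partial>circle_measure)"
    by (rule circle_integral(2)[symmetric]) (intro continuous_intros cont)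
  also have "\<dots> = (\<integral>x. \<phi> x \<partial>?M)"
    by (subst integral_real_density) (use meas cont f0 in \<open>auto simp: mult.commute\<close>)
  also have "\<dots> = (\<integral>x. \<phi> x \<partial>distr ?M circle_measure (\<lambda>x. frac (T x)))" by (simp only: dis)
  also have "\<dots> = (\<integral>x. \<phi> (frac (T x)) \<partial>?M)"
    using frac_circle_measurable[OF cont(1)] meas[OF cont(3)]
    by (intro integral_distr) (simp_all add: measurable_def)
  also have "\<dots> = (\<integral>x. \<phi> (T x) \<partial>?M)" by (simp add: periodic_frac[OF per])
  also have "\<dots> = (\<integral>x. \<phi> (T x) * f x \<partial>circle_measure)"
    by (subst integral_real_density) (use meas comp cont f0 in \<open>auto simp: mult.commute\<close>)
  also have "\<dots> = integral {0..1} (\<lambda>x. \<phi> (T x) * f x)"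
    by (rule circle_integral(2)) (intro continuous_intros cont comp)
  finally show ?thesis by simp
qed

text \<open>
  Invariance is tested on \<open>\<phi> = f - transfer T f\<close>. As the operator is dual to composition
  with \<open>T\<close>, the integrals of \<open>\<phi> * f\<close> and \<open>\<phi> * transfer T f\<close> agree, that is, \<open>\<phi>\<^sup>2\<close> has integral \<open>0\<close>.
  A continuous \<open>\<phi>\<close> with this property vanishes at every point.
\<close>

lemma (in expanding_lift) invariant_density_transfer:
  assumes inv: "invariant_probability_density T f" and f: "continuous_on UNIV f"
  shows "transfer T f = f"
proof -
  have per: "periodic f" using inv by (simp add: invariant_probability_density_def)
  have T: "continuous_on UNIV T" by (rule DERIV_continuous_on) (rule has_field_derivative_at_within[OF deriv_T])
  define \<phi> where "\<phi> = (\<lambda>x. f x - transfer T f x)"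
  have \<phi>: "continuous_on UNIV \<phi>" "periodic \<phi>"
    using f transfer_continuous[OF per f] per transfer_periodic[of T f]
    by (auto simp: \<phi>_def periodic_def intro!: continuous_intros)
  have pf: "periodic (\<lambda>x. \<phi> (T x) * f x)"
    unfolding periodic_def
  proof
    fix x
    show "\<phi> (T (x + 1)) * f (x + 1) = \<phi> (T x) * f x"
      using periodic_shift_int[OF \<phi>(2), of "T x" "int d"] per by (simp add: degree periodic_def)
  qed
  have \<phi>_shift: "\<phi> (x + real k) = \<phi> x" for x k
    using periodic_shift_int[OF \<phi>(2), of x "int k"] by simp
  have pull: "transfer T (\<lambda>x. \<phi> (T x) * f x) = (\<lambda>x. \<phi> x * transfer T f x)"
    unfolding fun_eq_iff transfer_eq[OF pf] transfer_eq[OF per] sum_distrib_left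
    by (simp add: \<phi>_shift)
  have comp: "continuous_on UNIV (\<lambda>x. \<phi> (T x))"
    by (rule continuous_on_compose2[OF \<phi>(1) T]) auto
  have int: "g integrable_on {0..1}" if "continuous_on UNIV g" for g :: "real \<Rightarrow> real"
    using that by (intro integrable_continuous_real) (auto intro: continuous_on_subset)
  have Lf: "continuous_on UNIV (transfer T f)" by (rule transfer_continuous[OF per f])
  have "integral {0..1} (\<lambda>x. \<phi> x * f x) = integral {0..1} (\<lambda>x. \<phi> (T x) * f x)"
    by (rule invariant_integral[OF inv T f \<phi>, symmetric])
  also have "\<dots> = integral {0..1} (transfer T (\<lambda>x. \<phi> (T x) * f x))"
    by (rule transfer_integral[symmetric, OF pf]) (intro continuous_intros comp f)
  also have "\<dots> = integral {0..1} (\<lambda>x. \<phi> x * transfer T f x)" by (simp add: pull)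
  finally have "integral {0..1} (\<lambda>x. \<phi> x * f x) - integral {0..1} (\<lambda>x. \<phi> x * transfer T f x) = 0" by simp
  hence "integral {0..1} (\<lambda>x. \<phi> x * f x - \<phi> x * transfer T f x) = 0"
    by (subst integral_diff) (intro int continuous_intros \<phi> f Lf | simp)+
  hence "integral {0..1} (\<lambda>x. (\<phi> x)\<^sup>2) = 0" by (simp add: \<phi>_def algebra_simps power2_eq_square)
  moreover have c2: "continuous_on {0..1} (\<lambda>x. (\<phi> x)\<^sup>2)"
    by (intro continuous_intros continuous_on_subset[OF \<phi>(1)]) auto
  ultimately have "((\<lambda>x. (\<phi> x)\<^sup>2) has_integral 0) {0..1}"
    using integrable_integral[OF integrable_continuous_real[OF c2]] by simp
  hence z: "(\<phi> x)\<^sup>2 = 0" if "x \<in> {0..1}" for x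
    using has_integral_0_cbox_imp_0[of 0 1 "\<lambda>x. (\<phi> x)\<^sup>2" x] c2 that by simp
  have "\<phi> x = 0" for x
    using z[of "frac x"] periodic_frac[OF \<phi>(2), of x] frac_lt_1[of x] by simp
  thus ?thesis by (auto simp: \<phi>_def)
qed

section \<open>Bounded uniform limits\<close>

text \<open>
  Uniform limits are compatible with products and quotients only if the limits are bounded. Carrying
  boundedness along makes the class closed under the operations that occur below.
\<close>

definition bounded_uniform_limit ::
    "'b set \<Rightarrow> ('a \<Rightarrow> 'b \<Rightarrow> real) \<Rightarrow> ('b \<Rightarrow> real) \<Rightarrow> 'a filter \<Rightarrow> bool" where
  "bounded_uniform_limit X f l F \<longleftrightarrow> uniform_limit X f l F \<and> bounded (l ` X)"

lemma bul_const: "bounded (l ` X) \<Longrightarrow> bounded_uniform_limit X (\<lambda>_. l) l F"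
  by (simp add: bounded_uniform_limit_def uniform_limit_const)

lemma bul_add:
  assumes "bounded_uniform_limit X f l F" "bounded_uniform_limit X g m F"
  shows "bounded_uniform_limit X (\<lambda>n x. f n x + g n x) (\<lambda>x. l x + m x) F"
  using assms by (auto simp: bounded_uniform_limit_def intro: uniform_limit_add bounded_plus_comp)

lemma bul_diff:
  assumes "bounded_uniform_limit X f l F" "bounded_uniform_limit X g m F"
  shows "bounded_uniform_limit X (\<lambda>n x. f n x - g n x) (\<lambda>x. l x - m x) F"
  using assms by (auto simp: bounded_uniform_limit_def intro: uniform_limit_minus bounded_minus_comp)

lemma bul_uminus:
  assumes "bounded_uniform_limit X f l F"
  shows "bounded_uniform_limit X (\<lambda>n x. - f n x) (\<lambda>x. - l x) F"
  using assms by (auto simp: bounded_uniform_limit_def intro: uniform_limit_uminus)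

lemma bul_mult:
  assumes "bounded_uniform_limit X f l F" "bounded_uniform_limit X g m F"
  shows "bounded_uniform_limit X (\<lambda>n x. f n x * g n x) (\<lambda>x. l x * m x) F"
proof -
  have b: "bounded (l ` X)" "bounded (m ` X)" using assms by (auto simp: bounded_uniform_limit_def)
  then obtain A B where "\<forall>x\<in>X. \<bar>l x\<bar> \<le> A" "\<forall>x\<in>X. \<bar>m x\<bar> \<le> B" by (auto simp: bounded_iff)
  hence "\<forall>x\<in>X. \<bar>l x * m x\<bar> \<le> A * B"
    unfolding abs_mult by (auto intro!: mult_mono intro: order_trans[OF abs_ge_zero])
  hence "bounded ((\<lambda>x. l x * m x) ` X)" by (auto simp: bounded_iff)
  thus ?thesis using assms b by (auto simp: bounded_uniform_limit_def intro: uniform_lim_mult)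
qed

lemma bul_inverse:
  assumes "bounded_uniform_limit X f l F" "\<And>x. x \<in> X \<Longrightarrow> 1 \<le> l x"
  shows "bounded_uniform_limit X (\<lambda>n x. inverse (f n x)) (\<lambda>x. inverse (l x)) F"
proof -
  have "uniform_limit X (\<lambda>n x. inverse (f n x)) (inverse \<circ> l) F"
    using assms by (intro uniform_lim_inverse[where b = 1]) (force simp: bounded_uniform_limit_def)+
  moreover have "bounded ((\<lambda>x. inverse (l x)) ` X)"
    unfolding bounded_iff by (rule exI[of _ 1]) (use assms(2) in \<open>force simp: inverse_le_1_iff\<close>)
  ultimately show ?thesis by (simp add: bounded_uniform_limit_def o_def)
qed

lemma bul_divide:
  assumes "bounded_uniform_limit X f l F" "bounded_uniform_limit X g m F" "\<And>x. x \<in> X \<Longrightarrow> 1 \<le> m x"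
  shows "bounded_uniform_limit X (\<lambda>n x. f n x / g n x) (\<lambda>x. l x / m x) F"
  unfolding divide_inverse by (intro bul_mult bul_inverse assms)

lemmas bul_intros = bul_add bul_diff bul_uminus bul_mult bul_divide

lemma bul_parameter:
  "((\<lambda>\<delta>. \<delta>) \<longlongrightarrow> c) F \<Longrightarrow> bounded_uniform_limit X (\<lambda>\<delta> x. \<delta>) (\<lambda>_. c) F"
  by (auto simp: bounded_uniform_limit_def uniform_limit_iff tendsto_iff bounded_iff intro: eventually_mono)

lemma bul_compose:
  assumes "bounded_uniform_limit Y f l F" "h ` X \<subseteq> Y"
  shows "bounded_uniform_limit X (\<lambda>n x. f n (h x)) (\<lambda>x. l (h x)) F"
proof -
  have "h \<in> X \<rightarrow> Y" using assms(2) by auto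
  moreover have "bounded ((\<lambda>x. l (h x)) ` X)"
    using assms by (auto simp: bounded_uniform_limit_def intro: bounded_subset)
  ultimately show ?thesis
    using assms(1) unfolding bounded_uniform_limit_def
    by (blast intro: uniform_limit_compose'[where A = Y and h = h])
qed

lemma bul_sum:
  assumes "\<And>k. k < (N::nat) \<Longrightarrow> bounded_uniform_limit X (f k) (l k) F"
  shows "bounded_uniform_limit X (\<lambda>n x. \<Sum>k<N. f k n x) (\<lambda>x. \<Sum>k<N. l k x) F"
  using assms
proof (induction N)
  case 0
  have "bounded ((\<lambda>x. 0::real) ` X)" by (auto simp: bounded_iff)
  thus ?case using bul_const by simp
next
  case (Suc N)
  thus ?case by (simp add: bul_add)
qed

lemma bul_eventually_le:
  assumes "bounded_uniform_limit X f l F" "0 < e"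
  shows "\<forall>\<^sub>F n in F. \<forall>x\<in>X. \<bar>f n x - l x\<bar> \<le> e"
proof -
  have "\<forall>\<^sub>F n in F. \<forall>x\<in>X. dist (f n x) (l x) < e"
    using assms by (auto simp: bounded_uniform_limit_def uniform_limit_iff)
  thus ?thesis by eventually_elim (auto simp: dist_real_def intro: less_imp_le)
qed

lemma bul_eventually_bounded:
  assumes "bounded_uniform_limit X f l F"
  obtains K where "0 < K" "\<forall>\<^sub>F n in F. \<forall>x\<in>X. \<bar>f n x\<bar> \<le> K"
proof -
  obtain B where B: "\<forall>x\<in>X. \<bar>l x\<bar> \<le> B" using assms by (auto simp: bounded_uniform_limit_def bounded_iff)
  have "\<forall>\<^sub>F n in F. \<forall>x\<in>X. \<bar>f n x\<bar> \<le> max B 0 + 1"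
    using bul_eventually_le[OF assms zero_less_one] by eventually_elim (use B in force)
  thus thesis by (rule that[rotated]) simp
qed

lemma bulI:
  assumes "\<And>e. 0 < e \<Longrightarrow> \<forall>\<^sub>F n in F. \<forall>x\<in>X. \<bar>f n x - l x\<bar> \<le> e" and "bounded (l ` X)"
  shows "bounded_uniform_limit X f l F"
  unfolding bounded_uniform_limit_def
proof
  show "uniform_limit X f l F"
  proof (rule uniform_limitI)
    fix e :: real assume "0 < e"
    hence "\<forall>\<^sub>F n in F. \<forall>x\<in>X. \<bar>f n x - l x\<bar> \<le> e / 2" by (intro assms) simp
    thus "\<forall>\<^sub>F n in F. \<forall>x\<in>X. dist (f n x) (l x) < e"
      by eventually_elim (use \<open>0 < e\<close> in \<open>force simp: dist_real_def\<close>)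
  qed
qed (rule assms)

lemma periodic_bounded_range:
  fixes f :: "real \<Rightarrow> real"
  assumes "periodic f" "continuous_on UNIV f"
  shows "bounded (range f)"
  using periodic_continuous_bound[OF assms] by (auto simp: bounded_iff)

section \<open>Perturbed families\<close>

text \<open>
  The derivative of the transfer operator, applied to \<open>w\<close>, when the map moves with velocity \<open>V\<close> is
  the transfer of this function. Derivatives are passed as separate arguments so that it can be used at each map
  of a family. It equals \<open>- (w * V / T1)'\<close>.
\<close>

definition transfer_variation ::
    "(real \<Rightarrow> real) \<Rightarrow> (real \<Rightarrow> real) \<Rightarrow> (real \<Rightarrow> real) \<Rightarrow> (real \<Rightarrow> real) \<Rightarrow>
     (real \<Rightarrow> real) \<Rightarrow> (real \<Rightarrow> real) \<Rightarrow> real \<Rightarrow> real" where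
  "transfer_variation T1 T2 V V1 w w1 y =
    - (w y * V1 y / T1 y) - V y * w1 y / T1 y + V y * T2 y / (T1 y)\<^sup>2 * w y"

text \<open>
  The functions \<open>R \<delta>\<close> are remainders of order \<open>o(\<delta>)\<close>. All maps between \<open>T\<close> and the perturbed map
  have the same bounds \<open>l\<close> and \<open>D\<close>, hence the same rate of decay.
\<close>

locale perturbed_family = expanding_lift T T1 T2 d l D
  for T T1 T2 :: "real \<Rightarrow> real" and d :: nat and l D :: real +
  fixes V V1 V2 :: "real \<Rightarrow> real" and R R1 R2 :: "real \<Rightarrow> real \<Rightarrow> real"
  assumes T2_cont: "continuous_on UNIV T2"
    and V: "periodic V" "\<And>x. (V has_real_derivative V1 x) (at x)" "\<And>x. (V1 has_real_derivative V2 x) (at x)"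
    and V2_cont: "continuous_on UNIV V2"
    and R: "\<forall>\<^sub>F \<delta> in at_right 0. periodic (R \<delta>) \<and> (\<forall>x. (R \<delta> has_real_derivative R1 \<delta> x) (at x) \<and>
      (R1 \<delta> has_real_derivative R2 \<delta> x) (at x))"
    and R_small: "bounded_uniform_limit UNIV (\<lambda>\<delta> x. R \<delta> x / \<delta>) (\<lambda>_. 0) (at_right 0)"
      "bounded_uniform_limit UNIV (\<lambda>\<delta> x. R1 \<delta> x / \<delta>) (\<lambda>_. 0) (at_right 0)"
      "bounded_uniform_limit UNIV (\<lambda>\<delta> x. R2 \<delta> x / \<delta>) (\<lambda>_. 0) (at_right 0)"
    and segment: "\<forall>\<^sub>F \<delta> in at_right 0. \<forall>s\<in>{0..1}. expanding_lift (\<lambda>y. T y + s * (\<delta> * V y + R \<delta> y))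
      (\<lambda>y. T1 y + s * (\<delta> * V1 y + R1 \<delta> y)) (\<lambda>y. T2 y + s * (\<delta> * V2 y + R2 \<delta> y)) d l D"
begin

definition Tp where "Tp \<delta> y = T y + (\<delta> * V y + R \<delta> y)"
definition Tp1 where "Tp1 \<delta> y = T1 y + (\<delta> * V1 y + R1 \<delta> y)"
definition Tp2 where "Tp2 \<delta> y = T2 y + (\<delta> * V2 y + R2 \<delta> y)"

lemma V_cont: "continuous_on UNIV V" "continuous_on UNIV V1"
  by (rule DERIV_continuous_on, rule has_field_derivative_at_within, rule V)+

lemma V_periodic: "periodic V1" "periodic V2"
  using periodic_deriv[of V V1] periodic_deriv[of V1 V2] V by auto

lemma bounded_ranges:
  "bounded (range T1)" "bounded (range T2)" "bounded (range V)" "bounded (range V1)" "bounded (range V2)"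
  by (intro periodic_bounded_range T1_cont T1_periodic T2_cont T2_periodic V V_cont V2_cont V_periodic)+

lemma perturbation_limits:
  "bounded_uniform_limit UNIV (\<lambda>\<delta> x. V x + R \<delta> x / \<delta>) V (at_right 0)"
  "bounded_uniform_limit UNIV (\<lambda>\<delta> x. V1 x + R1 \<delta> x / \<delta>) V1 (at_right 0)"
  "bounded_uniform_limit UNIV (\<lambda>\<delta> x. V2 x + R2 \<delta> x / \<delta>) V2 (at_right 0)"
  using bul_add[OF bul_const R_small(1), of V] bul_add[OF bul_const R_small(2), of V1]
    bul_add[OF bul_const R_small(3), of V2] bounded_ranges by simp_all

lemma eventually_pos: "\<forall>\<^sub>F \<delta> in at_right 0. (0::real) < \<delta>"
  by (simp add: eventually_at_right_less)

lemma parameter_limit: "bounded_uniform_limit X (\<lambda>\<delta> x. \<delta>) (\<lambda>_. 0) (at_right (0::real))"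
  by (rule bul_parameter) (rule tendsto_ident_at)

lemma family_lift: "\<forall>\<^sub>F \<delta> in at_right 0. expanding_lift (Tp \<delta>) (Tp1 \<delta>) (Tp2 \<delta>) d l D"
  using segment
proof eventually_elim
  case (elim \<delta>)
  from elim[rule_format, of 1] show ?case by (simp add: Tp_def[abs_def] Tp1_def[abs_def] Tp2_def[abs_def])
qed

text \<open>
  The limits are uniform in the position \<open>s\<close> on the segment as well, since the mean value theorem
  picks an \<open>s\<close> that depends on the point.
\<close>

lemma segment_limits:
  defines "X \<equiv> {0..1::real} \<times> (UNIV :: real set)"
  shows "bounded_uniform_limit X (\<lambda>\<delta> (s, y). T y + s * (\<delta> * V y + R \<delta> y) - T y) (\<lambda>_. 0) (at_right 0)"
    "bounded_uniform_limit X (\<lambda>\<delta> (s, y). T1 y + s * (\<delta> * V1 y + R1 \<delta> y)) (\<lambda>(s, y). T1 y) (at_right 0)"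
    "bounded_uniform_limit X (\<lambda>\<delta> (s, y). T2 y + s * (\<delta> * V2 y + R2 \<delta> y)) (\<lambda>(s, y). T2 y) (at_right 0)"
proof -
  have s: "bounded ((fst :: real \<times> real \<Rightarrow> real) ` X)" unfolding X_def
    by (rule bounded_subset[of "{0..1}"]) auto
  have *: "bounded_uniform_limit X (\<lambda>\<delta> (s, y). f y + s * (\<delta> * v y + r \<delta> y)) (\<lambda>(s, y). f y) (at_right 0)"
    if f: "bounded (range f)" and W: "bounded_uniform_limit UNIV (\<lambda>\<delta> x. v x + r \<delta> x / \<delta>) v (at_right 0)"
    for f v and r :: "real \<Rightarrow> real \<Rightarrow> real"
  proof -
    have "bounded ((\<lambda>z :: real \<times> real. f (snd z)) ` X)"
      by (rule bounded_subset[OF f]) auto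
    from bul_add[OF bul_const[OF this] bul_mult[OF bul_const[OF s] bul_mult[OF parameter_limit bul_compose[OF W subset_UNIV]]],
        of snd]
    have "bounded_uniform_limit X (\<lambda>\<delta> z. f (snd z) + fst z * (\<delta> * (v (snd z) + r \<delta> (snd z) / \<delta>)))
      (\<lambda>z. f (snd z) + fst z * (0 * v (snd z))) (at_right 0)" .
    moreover have "\<forall>\<^sub>F \<delta> in at_right 0. \<forall>z\<in>X.
        f (snd z) + fst z * (\<delta> * (v (snd z) + r \<delta> (snd z) / \<delta>)) = (case z of (s, y) \<Rightarrow> f y + s * (\<delta> * v y + r \<delta> y))"
      using eventually_pos by eventually_elim (auto simp: field_simps)
    ultimately show ?thesis
      unfolding bounded_uniform_limit_def
      by (subst (asm) uniform_limit_cong) (auto simp: case_prod_unfold)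
  qed
  show "bounded_uniform_limit X (\<lambda>\<delta> (s, y). T y + s * (\<delta> * V y + R \<delta> y) - T y) (\<lambda>_. 0) (at_right 0)"
    using *[of "\<lambda>_. 0", OF _ perturbation_limits(1)]
    by (simp add: case_prod_unfold image_def)
  show "bounded_uniform_limit X (\<lambda>\<delta> (s, y). T1 y + s * (\<delta> * V1 y + R1 \<delta> y)) (\<lambda>(s, y). T1 y) (at_right 0)"
    by (rule *) (rule bounded_ranges perturbation_limits)+
  show "bounded_uniform_limit X (\<lambda>\<delta> (s, y). T2 y + s * (\<delta> * V2 y + R2 \<delta> y)) (\<lambda>(s, y). T2 y) (at_right 0)"
    by (rule *) (rule bounded_ranges perturbation_limits)+
qed

lemma transfer_variation_regular:
  assumes w: "periodic w" "\<And>x. (w has_real_derivative w1 x) (at x)" "continuous_on UNIV w1"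
  shows "periodic (transfer_variation T1 T2 V V1 w w1)"
    "continuous_on UNIV (transfer_variation T1 T2 V V1 w w1)"
proof -
  have "continuous_on UNIV w" by (rule DERIV_continuous_on) (rule has_field_derivative_at_within[OF w(2)])
  moreover have "periodic w1" using w periodic_deriv by blast
  ultimately show "periodic (transfer_variation T1 T2 V V1 w w1)"
    "continuous_on UNIV (transfer_variation T1 T2 V V1 w w1)"
    unfolding transfer_variation_def
    using w V T1_periodic T2_periodic V_periodic V_cont T1_cont T2_cont T1_nz
    by (auto simp: periodic_def intro!: continuous_intros)
qed

text \<open>
  The difference of the operators is \<open>\<delta>\<close> times the transfer, under a map of the segment, of the
  variation with velocity \<open>V + R \<delta> / \<delta>\<close>. As \<open>\<delta>\<close> tends to \<open>0\<close>, this variation tends to the one at \<open>T\<close> with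
  velocity \<open>V\<close>, and the stability of the transfer operator applies.
\<close>

lemma first_order_response:
  assumes w: "periodic w" "\<And>x. (w has_real_derivative w1 x) (at x)" "continuous_on UNIV w1"
  shows "bounded_uniform_limit UNIV (\<lambda>\<delta> x. (transfer (Tp \<delta>) w x - transfer T w x) / \<delta>)
    (transfer T (transfer_variation T1 T2 V V1 w w1)) (at_right 0)"
proof -
  define X where "X = {0..1::real} \<times> (UNIV :: real set)"
  define p where "p = transfer_variation T1 T2 V V1 w w1"
  define T1s where "T1s = (\<lambda>\<delta> s y. T1 y + s * (\<delta> * V1 y + R1 \<delta> y))"
  define T2s where "T2s = (\<lambda>\<delta> s y. T2 y + s * (\<delta> * V2 y + R2 \<delta> y))"
  define W where "W = (\<lambda>\<delta> y. V y + R \<delta> y / \<delta>)"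
  define W1 where "W1 = (\<lambda>\<delta> y. V1 y + R1 \<delta> y / \<delta>)"
  define P where "P = (\<lambda>\<delta> s. transfer_variation (T1s \<delta> s) (T2s \<delta> s) (W \<delta>) (W1 \<delta>) w w1)"
  have wc: "continuous_on UNIV w" by (rule DERIV_continuous_on) (rule has_field_derivative_at_within[OF w(2)])
  have w1p: "periodic w1" using w periodic_deriv by blast
  have p: "periodic p" "continuous_on UNIV p"
    unfolding p_def by (rule transfer_variation_regular[OF w])+
  have bnd: "bounded ((\<lambda>z. f (snd z)) ` X)" if "periodic f" "continuous_on UNIV f" for f :: "real \<Rightarrow> real"
    using periodic_bounded_range[OF that] by (rule bounded_subset) auto
  have lims: "bounded_uniform_limit X (\<lambda>\<delta> z. W \<delta> (snd z)) (\<lambda>z. V (snd z)) (at_right 0)"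
    "bounded_uniform_limit X (\<lambda>\<delta> z. W1 \<delta> (snd z)) (\<lambda>z. V1 (snd z)) (at_right 0)"
    unfolding W_def W1_def by (rule bul_compose[where h = snd and Y = UNIV], rule perturbation_limits, simp)+
  have lims2: "bounded_uniform_limit X (\<lambda>\<delta> z. T1s \<delta> (fst z) (snd z)) (\<lambda>z. T1 (snd z)) (at_right 0)"
    "bounded_uniform_limit X (\<lambda>\<delta> z. T2s \<delta> (fst z) (snd z)) (\<lambda>z. T2 (snd z)) (at_right 0)"
    using segment_limits(2,3) unfolding X_def T1s_def T2s_def case_prod_unfold by simp_all
  have lim: "bounded_uniform_limit X (\<lambda>\<delta> (s, y). P \<delta> s y) (\<lambda>(s, y). p y) (at_right 0)"
    unfolding P_def p_def transfer_variation_def case_prod_unfold power2_eq_square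
    by (intro bul_intros bul_const bnd w wc w1p mult_ge1_I lims lims2)
      (auto intro: less_imp_le T1_gt_1)
  show ?thesis
    unfolding p_def[symmetric]
  proof (rule bulI)
    show "bounded (range (transfer T p))"
      using p by (intro periodic_bounded_range transfer_periodic transfer_continuous)
    fix e :: real assume "0 < e"
    from transfer_stable[OF p this] obtain r where r: "0 < r"
      "\<And>T' T1' T2' l' D' p' x. expanding_lift T' T1' T2' d l' D' \<Longrightarrow> periodic p' \<Longrightarrow>
       (\<And>y. \<bar>T' y - T y\<bar> \<le> r) \<Longrightarrow> (\<And>y. \<bar>T1' y - T1 y\<bar> \<le> r) \<Longrightarrow> (\<And>y. \<bar>p' y - p y\<bar> \<le> r) \<Longrightarrow>
       \<bar>transfer T' p' x - transfer T p x\<bar> \<le> e" by metis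
    show "\<forall>\<^sub>F \<delta> in at_right 0. \<forall>x\<in>UNIV.
        \<bar>(transfer (Tp \<delta>) w x - transfer T w x) / \<delta> - transfer T p x\<bar> \<le> e"
      using eventually_pos R segment bul_eventually_le[OF lim r(1)]
        bul_eventually_le[OF segment_limits(1) r(1)] bul_eventually_le[OF segment_limits(2) r(1)]
    proof eventually_elim
      case (elim \<delta>)
      note \<delta> = elim(1)
      have U: "\<And>x. ((\<lambda>y. \<delta> * V y + R \<delta> y) has_real_derivative \<delta> * V1 x + R1 \<delta> x) (at x)"
        "\<And>x. ((\<lambda>y. \<delta> * V1 y + R1 \<delta> y) has_real_derivative \<delta> * V2 x + R2 \<delta> x) (at x)"
        using elim(2) by (auto intro!: derivative_eq_intros V)
      have Up: "periodic (\<lambda>y. \<delta> * V y + R \<delta> y)" using elim(2) V(1) by (simp add: periodic_def)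
      show ?case
      proof
        fix x
        obtain s where s: "s \<in> {0..1}" and eq: "transfer (Tp \<delta>) w x - transfer T w x =
          transfer (\<lambda>y. T y + s * (\<delta> * V y + R \<delta> y))
           (transfer_variation (T1s \<delta> s) (T2s \<delta> s) (\<lambda>y. \<delta> * V y + R \<delta> y) (\<lambda>y. \<delta> * V1 y + R1 \<delta> y) w w1) x"
          using transfer_segment_mvt[OF _ deriv_T deriv_T1 U Up w(1,2), of d l D x] elim(3)
          by (auto simp: Tp_def[abs_def] transfer_variation_def[abs_def] T1s_def T2s_def)
        have var: "transfer_variation (T1s \<delta> s) (T2s \<delta> s) (\<lambda>y. \<delta> * V y + R \<delta> y) (\<lambda>y. \<delta> * V1 y + R1 \<delta> y) w w1
            = (\<lambda>y. \<delta> * P \<delta> s y)"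
        proof
          fix y
          have "\<delta> * V y + R \<delta> y = \<delta> * W \<delta> y" "\<delta> * V1 y + R1 \<delta> y = \<delta> * W1 \<delta> y"
            using \<delta> by (auto simp: W_def W1_def field_simps)
          thus "transfer_variation (T1s \<delta> s) (T2s \<delta> s) (\<lambda>y. \<delta> * V y + R \<delta> y) (\<lambda>y. \<delta> * V1 y + R1 \<delta> y) w w1 y
            = \<delta> * P \<delta> s y"
            unfolding P_def transfer_variation_def by (simp add: algebra_simps)
        qed
        have "(transfer (Tp \<delta>) w x - transfer T w x) / \<delta> = transfer (\<lambda>y. T y + s * (\<delta> * V y + R \<delta> y)) (P \<delta> s) x"
          unfolding eq var transfer_cmult using \<delta> by simp
        also have "\<bar>\<dots> - transfer T p x\<bar> \<le> e"
        proof (rule r(2))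
          show L: "expanding_lift (\<lambda>y. T y + s * (\<delta> * V y + R \<delta> y)) (T1s \<delta> s) (T2s \<delta> s) d l D"
            using elim(3) s by (simp add: T1s_def T2s_def)
          interpret L: expanding_lift "\<lambda>y. T y + s * (\<delta> * V y + R \<delta> y)" "T1s \<delta> s" "T2s \<delta> s" d l D by (rule L)
          have "periodic (R1 \<delta>)" using elim(2) periodic_deriv by blast
          thus "periodic (P \<delta> s)"
            using L.T1_periodic L.T2_periodic V V_periodic elim(2) w w1p
            by (simp add: P_def transfer_variation_def W_def W1_def periodic_def)
          fix y
          show "\<bar>T y + s * (\<delta> * V y + R \<delta> y) - T y\<bar> \<le> r" "\<bar>T1s \<delta> s y - T1 y\<bar> \<le> r" "\<bar>P \<delta> s y - p y\<bar> \<le> r"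
            using elim(4,5,6) s by (auto simp: X_def T1s_def)
        qed
        finally show "\<bar>(transfer (Tp \<delta>) w x - transfer T w x) / \<delta> - transfer T p x\<bar> \<le> e" .
      qed
    qed
  qed
qed

end

section \<open>Uniform linear response\<close>

lemma geometric_tail:
  fixes b :: "nat \<Rightarrow> real"
  assumes "\<And>n. \<bar>b n\<bar> \<le> M * \<theta> ^ n" "0 \<le> \<theta>" "\<theta> < 1"
  shows "summable b" "\<bar>suminf b - (\<Sum>n<N. b n)\<bar> \<le> M * \<theta> ^ N / (1 - \<theta>)"
proof -
  have g: "summable (\<lambda>n. M * \<theta> ^ n)" using assms by (intro summable_mult summable_geometric) simp
  show b: "summable b" by (rule summable_comparison_test'[OF g]) (use assms in simp)
  have g': "(\<lambda>n. M * \<theta> ^ (n + N)) sums (M * \<theta> ^ N * (1 / (1 - \<theta>)))"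
    using sums_mult[OF geometric_sums[of \<theta>], of "M * \<theta> ^ N"] assms by (simp add: power_add mult_ac)
  have n: "summable (\<lambda>n. \<bar>b (n + N)\<bar>)"
    by (rule summable_comparison_test'[OF sums_summable[OF g']]) (use assms in simp)
  have "suminf b - (\<Sum>n<N. b n) = (\<Sum>n. b (n + N))" by (rule suminf_minus_initial_segment[OF b, symmetric])
  also have "\<bar>\<dots>\<bar> \<le> (\<Sum>n. \<bar>b (n + N)\<bar>)" by (rule summable_rabs[OF n])
  also have "\<dots> \<le> (\<Sum>n. M * \<theta> ^ (n + N))"
    by (rule suminf_le[OF _ n sums_summable[OF g']]) (rule assms)
  also have "\<dots> = M * \<theta> ^ N / (1 - \<theta>)" using sums_unique[OF g'] by simp
  finally show "\<bar>suminf b - (\<Sum>n<N. b n)\<bar> \<le> M * \<theta> ^ N / (1 - \<theta>)" .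
qed

lemma transfer_pow_telescope:
  assumes "\<And>x. u x - transfer T u x = q x"
  shows "(\<Sum>n<N. (transfer T ^^ n) q x) = u x - (transfer T ^^ N) u x"
proof -
  have "(transfer T ^^ n) q x = (transfer T ^^ n) u x - (transfer T ^^ Suc n) u x" for n
  proof -
    have "q = (\<lambda>x. u x - transfer T u x)" using assms by auto
    hence "(transfer T ^^ n) q x = (transfer T ^^ n) u x - (transfer T ^^ n) (transfer T u) x"
      by (simp only: transfer_pow_diff)
    thus ?thesis by (simp only: funpow_Suc_right o_apply)
  qed
  hence "(\<Sum>n<N. (transfer T ^^ n) q x) = (\<Sum>n<N. (transfer T ^^ n) u x - (transfer T ^^ Suc n) u x)" by simp
  also have "\<dots> = u x - (transfer T ^^ N) u x"
    by (subst sum_lessThan_telescope') simp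
  finally show ?thesis .
qed

text \<open>
  The partial sums telescope to \<open>u - L\<^sup>N u\<close>, and the last term decays.
\<close>

lemma (in expanding_lift) neumann_series:
  assumes u: "periodic u" "\<And>x. (u has_real_derivative u1 x) (at x)" "continuous_on UNIV u1"
    and zero: "integral {0..1} u = 0" and q: "\<And>x. u x - transfer T u x = q x"
  shows "(\<lambda>n. (transfer T ^^ n) q x) sums u x"
proof -
  have uc: "continuous_on UNIV u" by (rule DERIV_continuous_on) (rule has_field_derivative_at_within[OF u(2)])
  obtain K0 where K0: "0 < K0" "\<And>x. \<bar>u x\<bar> \<le> K0" using periodic_continuous_bound[OF u(1) uc] by blast
  obtain K1 where K1: "0 < K1" "\<And>x. \<bar>u1 x\<bar> \<le> K1"
    using periodic_continuous_bound[OF periodic_deriv[OF u(2,1)] u(3)] by blast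
  define K where "K = max K0 K1"
  have dec: "\<bar>(transfer T ^^ n) u x\<bar> \<le> 2 * exp a * K * (1 - c) ^ n" for n
    by (rule zero_average_decay[OF u(1,2) _ _ _ zero])
      (use K0 K1 in \<open>auto simp: K_def le_max_iff_disj\<close>)
  have "(\<lambda>n. 2 * exp a * K * (1 - c) ^ n) \<longlonglongrightarrow> 2 * exp a * K * 0"
    using coupling by (intro tendsto_mult_left LIMSEQ_power_zero) auto
  hence lim0: "(\<lambda>n. 2 * exp a * K * (1 - c) ^ n) \<longlonglongrightarrow> 0" by simp
  have "(\<lambda>n. (transfer T ^^ n) u x) \<longlonglongrightarrow> 0"
    by (rule Lim_null_comparison[OF _ lim0]) (simp add: dec)
  from tendsto_diff[OF tendsto_const this, of "u x"] show ?thesis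
    by (simp add: sums_def transfer_pow_telescope[OF q])
qed

context perturbed_family
begin

lemma family_close:
  assumes "0 < r"
  shows "\<forall>\<^sub>F \<delta> in at_right 0. \<forall>y. \<bar>Tp \<delta> y - T y\<bar> \<le> r \<and> \<bar>Tp1 \<delta> y - T1 y\<bar> \<le> r"
  using bul_eventually_le[OF segment_limits(1) assms] bul_eventually_le[OF segment_limits(2) assms]
proof eventually_elim
  case (elim \<delta>)
  show ?case using elim(1)[rule_format, of "(1, _)"] elim(2)[rule_format, of "(1, _)"]
    by (simp add: Tp_def Tp1_def)
qed

lemma family_limits:
  "bounded_uniform_limit UNIV Tp1 T1 (at_right 0)"
proof (rule bulI)
  fix e :: real assume "0 < e"
  from family_close[OF this] show "\<forall>\<^sub>F \<delta> in at_right 0. \<forall>x\<in>UNIV. \<bar>Tp1 \<delta> x - T1 x\<bar> \<le> e"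
    by eventually_elim auto
qed (rule bounded_ranges)

lemma transfer_limit:
  assumes p: "periodic p" "continuous_on UNIV p" and "\<forall>\<^sub>F \<delta> in at_right 0. periodic (P \<delta>)"
    and "bounded_uniform_limit UNIV P p (at_right 0)"
  shows "bounded_uniform_limit UNIV (\<lambda>\<delta>. transfer (Tp \<delta>) (P \<delta>)) (transfer T p) (at_right 0)"
proof (rule bulI)
  show "bounded (range (transfer T p))"
    using p by (intro periodic_bounded_range transfer_periodic transfer_continuous)
  fix e :: real assume "0 < e"
  from transfer_stable[OF p this] obtain r where r: "0 < r"
    "\<And>T' T1' T2' l' D' p' x. expanding_lift T' T1' T2' d l' D' \<Longrightarrow> periodic p' \<Longrightarrow>
     (\<And>y. \<bar>T' y - T y\<bar> \<le> r) \<Longrightarrow> (\<And>y. \<bar>T1' y - T1 y\<bar> \<le> r) \<Longrightarrow> (\<And>y. \<bar>p' y - p y\<bar> \<le> r) \<Longrightarrow>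
     \<bar>transfer T' p' x - transfer T p x\<bar> \<le> e" by metis
  show "\<forall>\<^sub>F \<delta> in at_right 0. \<forall>x\<in>UNIV. \<bar>transfer (Tp \<delta>) (P \<delta>) x - transfer T p x\<bar> \<le> e"
    using family_lift family_close[OF r(1)] assms(3) bul_eventually_le[OF assms(4) r(1)]
  proof eventually_elim
    case (elim \<delta>)
    show ?case by (intro ballI r(2)[OF elim(1)]) (use elim in auto)
  qed
qed

lemma transfer_pow_limit:
  assumes p: "periodic p" "continuous_on UNIV p" and P: "\<forall>\<^sub>F \<delta> in at_right 0. periodic (P \<delta>)"
    and lim: "bounded_uniform_limit UNIV P p (at_right 0)"
  shows "bounded_uniform_limit UNIV (\<lambda>\<delta>. (transfer (Tp \<delta>) ^^ n) (P \<delta>)) ((transfer T ^^ n) p) (at_right 0)"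
proof (induction n)
  case (Suc n)
  have "\<forall>\<^sub>F \<delta> in at_right 0. periodic ((transfer (Tp \<delta>) ^^ n) (P \<delta>))"
    using P by eventually_elim (cases n, auto simp: transfer_periodic)
  with Suc transfer_pow_periodic_continuous[OF p] show ?case
    by (simp add: transfer_limit)
qed (simp add: lim)

text \<open>
  The derivative of \<open>transfer T w\<close> is \<open>transfer T G\<close> with \<open>G\<close> of class \<open>C\<^sup>1\<close>, and that of the
  perturbed transfer involves a perturbed \<open>Gp \<delta>\<close> in the same way. Hence the derivative of the quotient splits
  into the difference quotient of the operators at \<open>G\<close>, which converges by the first order response, and the transfer
  of \<open>H \<delta> = (Gp \<delta> - G) / \<delta>\<close>.
\<close>

lemma difference_quotient_C1_bounded:
  assumes w: "periodic w" "\<And>x. (w has_real_derivative w1 x) (at x)"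
      "\<And>x. (w1 has_real_derivative w2 x) (at x)" "continuous_on UNIV w2"
    and T3: "\<And>x. (T2 has_real_derivative T3 x) (at x)" "continuous_on UNIV T3"
  obtains K q1 where "0 < K" "\<forall>\<^sub>F \<delta> in at_right 0. \<forall>x. \<bar>(transfer (Tp \<delta>) w x - transfer T w x) / \<delta>\<bar> \<le> K \<and>
      ((\<lambda>x. (transfer (Tp \<delta>) w x - transfer T w x) / \<delta>) has_real_derivative q1 \<delta> x) (at x) \<and> \<bar>q1 \<delta> x\<bar> \<le> K"
proof -
  define q where "q = (\<lambda>\<delta> x. (transfer (Tp \<delta>) w x - transfer T w x) / \<delta>)"
  define G where "G = (\<lambda>y. w1 y / T1 y - w y * T2 y / (T1 y)\<^sup>2)"
  define G1 where "G1 = (\<lambda>y. (w2 y * T1 y - w1 y * T2 y) / (T1 y)\<^sup>2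
    - ((w1 y * T2 y + w y * T3 y) / (T1 y)\<^sup>2 - w y * T2 y * (2 * T2 y) / (T1 y) ^ 3))"
  define Gp where "Gp = (\<lambda>\<delta> y. w1 y / Tp1 \<delta> y - w y * Tp2 \<delta> y / (Tp1 \<delta> y)\<^sup>2)"
  define W1 where "W1 = (\<lambda>\<delta> y. V1 y + R1 \<delta> y / \<delta>)"
  define W2 where "W2 = (\<lambda>\<delta> y. V2 y + R2 \<delta> y / \<delta>)"
  \<comment> \<open>The quotient \<open>(Gp \<delta> - G) / \<delta>\<close> with \<open>\<delta>\<close> cancelled, so that its limit is visible.\<close>
  define H where "H = (\<lambda>\<delta> y. - (w1 y * W1 \<delta> y / (Tp1 \<delta> y * T1 y))
    - w y * (W2 \<delta> y / (Tp1 \<delta> y * Tp1 \<delta> y)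
        - T2 y * W1 \<delta> y * (T1 y + Tp1 \<delta> y) / ((Tp1 \<delta> y * Tp1 \<delta> y) * (T1 y * T1 y))))"
  have w1: "periodic w1" and w2: "periodic w2" using w periodic_deriv by blast+
  have wc: "continuous_on UNIV w" "continuous_on UNIV w1"
    by (rule DERIV_continuous_on, rule has_field_derivative_at_within, rule w)+
  have Gp0: "periodic G" using w w1 T1_periodic T2_periodic by (simp add: G_def periodic_def)
  have G1: "(G has_real_derivative G1 x) (at x)" for x
    unfolding G_def G1_def using T1_nz[of x]
    by (auto intro!: derivative_eq_intros w T3 deriv_T1 simp: field_simps power2_eq_square power3_eq_cube)
  have G1c: "continuous_on UNIV G1"
    unfolding G1_def by (intro continuous_intros w wc T1_cont T2_cont T3) (auto simp: T1_nz)
  have bw: "bounded (range w)" "bounded (range w1)"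
    by (intro periodic_bounded_range w w1 wc)+
  have "bounded_uniform_limit UNIV H (\<lambda>y. - (w1 y * V1 y / (T1 y * T1 y))
    - w y * (V2 y / (T1 y * T1 y) - T2 y * V1 y * (T1 y + T1 y) / ((T1 y * T1 y) * (T1 y * T1 y)))) (at_right 0)"
    unfolding H_def W1_def W2_def
    by (intro bul_intros bul_const bw bounded_ranges family_limits perturbation_limits mult_ge1_I)
      (auto intro: less_imp_le T1_gt_1)
  then obtain KH where KH: "0 < KH" "\<forall>\<^sub>F \<delta> in at_right 0. \<forall>x\<in>UNIV. \<bar>H \<delta> x\<bar> \<le> KH"
    by (rule bul_eventually_bounded)
  obtain KG where KG: "0 < KG"
    "\<forall>\<^sub>F \<delta> in at_right 0. \<forall>x\<in>UNIV. \<bar>(transfer (Tp \<delta>) G x - transfer T G x) / \<delta>\<bar> \<le> KG"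
    using bul_eventually_bounded[OF first_order_response[OF Gp0 G1 G1c]] by blast
  obtain Kq where Kq: "0 < Kq"
    "\<forall>\<^sub>F \<delta> in at_right 0. \<forall>x\<in>UNIV. \<bar>(transfer (Tp \<delta>) w x - transfer T w x) / \<delta>\<bar> \<le> Kq"
    using bul_eventually_bounded[OF first_order_response[OF w(1,2) wc(2)]] by blast
  define K where "K = max Kq (real d * KH + KG)"
  define q1 where "q1 = (\<lambda>\<delta> x. (transfer (Tp \<delta>) (Gp \<delta>) x - transfer T G x) / \<delta>)"
  have ev: "\<forall>\<^sub>F \<delta> in at_right 0. \<forall>x. \<bar>q \<delta> x\<bar> \<le> K \<and> (q \<delta> has_real_derivative q1 \<delta> x) (at x) \<and> \<bar>q1 \<delta> x\<bar> \<le> K"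
    using KH(2) KG(2) Kq(2) family_lift eventually_pos
  proof eventually_elim
    case (elim \<delta>)
    interpret L: expanding_lift "Tp \<delta>" "Tp1 \<delta>" "Tp2 \<delta>" d l D by (rule elim(4))
    have per: "periodic (Gp \<delta>)" using w w1 L.T1_periodic L.T2_periodic by (simp add: Gp_def periodic_def)
    have HG: "Gp \<delta> y - G y = \<delta> * H \<delta> y" for y
    proof -
      have nz: "Tp1 \<delta> y \<noteq> 0" "T1 y \<noteq> 0" "\<delta> \<noteq> 0" using L.T1_nz T1_nz elim(5) by auto
      have e: "\<delta> * W1 \<delta> y = Tp1 \<delta> y - T1 y" "\<delta> * W2 \<delta> y = Tp2 \<delta> y - T2 y"
        using nz by (auto simp: W1_def W2_def Tp1_def Tp2_def field_simps)
      have "\<delta> * H \<delta> y = - (w1 y * (\<delta> * W1 \<delta> y) / (Tp1 \<delta> y * T1 y))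
        - w y * ((\<delta> * W2 \<delta> y) / (Tp1 \<delta> y * Tp1 \<delta> y)
        - T2 y * (\<delta> * W1 \<delta> y) * (T1 y + Tp1 \<delta> y) / ((Tp1 \<delta> y * Tp1 \<delta> y) * (T1 y * T1 y)))"
        by (simp add: H_def algebra_simps)
      also have "\<dots> = Gp \<delta> y - G y"
        unfolding e Gp_def G_def using nz(1,2) by (simp add: field_simps power2_eq_square)
      finally show ?thesis by simp
    qed
    have Hper: "periodic (H \<delta>)"
    proof -
      have "H \<delta> = (\<lambda>y. (Gp \<delta> y - G y) / \<delta>)" using HG elim(5) by (auto simp: fun_eq_iff)
      thus ?thesis using per Gp0 by (simp add: periodic_def)
    qed
    show ?case
    proof (intro allI conjI)
      fix x
      show "\<bar>q \<delta> x\<bar> \<le> K" using elim(3) by (auto simp: q_def K_def intro: order_trans)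
      have "(transfer (Tp \<delta>) w has_real_derivative transfer (Tp \<delta>) (Gp \<delta>) x) (at x)"
        unfolding Gp_def by (rule L.transfer_deriv[OF w(1,2)])
      moreover have "(transfer T w has_real_derivative transfer T G x) (at x)"
        unfolding G_def by (rule transfer_deriv[OF w(1,2)])
      ultimately show "(q \<delta> has_real_derivative q1 \<delta> x) (at x)"
        unfolding q_def q1_def by (intro DERIV_cdivide DERIV_diff)
      have "Gp \<delta> = (\<lambda>y. \<delta> * H \<delta> y + 1 * G y)" using HG by (auto simp: fun_eq_iff algebra_simps)
      hence "transfer (Tp \<delta>) (Gp \<delta>) x = \<delta> * transfer (Tp \<delta>) (H \<delta>) x + 1 * transfer (Tp \<delta>) G x"
        by (simp only: transfer_linear)
      hence "q1 \<delta> x = transfer (Tp \<delta>) (H \<delta>) x + (transfer (Tp \<delta>) G x - transfer T G x) / \<delta>"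
        using elim(5) by (simp add: q1_def field_simps)
      also have "\<bar>\<dots>\<bar> \<le> real d * KH + KG"
        using L.transfer_bound[OF Hper, of KH x] elim(1,2)
        by (intro order_trans[OF abs_triangle_ineq] add_mono) auto
      finally show "\<bar>q1 \<delta> x\<bar> \<le> K" by (simp add: K_def)
    qed
  qed
  show thesis
  proof (rule that)
    show "0 < K" using Kq(1) by (simp add: K_def)
  qed (use ev in \<open>simp add: q_def\<close>)
qed

text \<open>
  Both the difference quotient of the fixed points and its limit are sums of series whose terms
  have the common bound \<open>M * \<theta>\<^sup>n\<close>, and each term of the one converges uniformly to the
  corresponding term of the other. The bound passes to the limit terms, where it is what makes the limit
  series converge.
\<close>

theorem uniform_linear_response:
  assumes w: "periodic w" "\<And>x. (w has_real_derivative w1 x) (at x)"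
      "\<And>x. (w1 has_real_derivative w2 x) (at x)" "continuous_on UNIV w2"
    and T3: "\<And>x. (T2 has_real_derivative T3 x) (at x)" "continuous_on UNIV T3"
    and fixed: "transfer T w = w"
    and g: "\<forall>\<^sub>F \<delta> in at_right 0. periodic (g \<delta>) \<and> (\<forall>x. (g \<delta> has_real_derivative g1 \<delta> x) (at x)) \<and>
      continuous_on UNIV (g1 \<delta>) \<and> transfer (Tp \<delta>) (g \<delta>) = g \<delta> \<and> integral {0..1} (g \<delta>) = integral {0..1} w"
  defines "q0 \<equiv> transfer T (transfer_variation T1 T2 V V1 w w1)"
  shows "\<exists>M \<theta>. 0 \<le> \<theta> \<and> \<theta> < 1 \<and> (\<forall>n x. \<bar>(transfer T ^^ n) q0 x\<bar> \<le> M * \<theta> ^ n)"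
    and "uniform_limit UNIV (\<lambda>\<delta> x. (g \<delta> x - w x) / \<delta>) (\<lambda>x. \<Sum>n. (transfer T ^^ n) q0 x) (at_right 0)"
proof -
  define q where "q = (\<lambda>\<delta> x. (transfer (Tp \<delta>) w x - transfer T w x) / \<delta>)"
  define \<theta> where "\<theta> = 1 - c"
  have \<theta>: "0 \<le> \<theta>" "\<theta> < 1" using coupling by (auto simp: \<theta>_def)
  have wc: "continuous_on UNIV w" "continuous_on UNIV w1"
    by (rule DERIV_continuous_on, rule has_field_derivative_at_within, rule w)+
  have int: "f integrable_on {0..1}" if "continuous_on UNIV f" for f :: "real \<Rightarrow> real"
    using that by (intro integrable_continuous_real) (auto intro: continuous_on_subset)
  obtain K q1 where K: "0 < K" "\<forall>\<^sub>F \<delta> in at_right 0. \<forall>x. \<bar>q \<delta> x\<bar> \<le> K \<and>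
      (q \<delta> has_real_derivative q1 \<delta> x) (at x) \<and> \<bar>q1 \<delta> x\<bar> \<le> K"
    by (rule difference_quotient_C1_bounded[OF w T3]) (erule that, simp only: q_def)
  define M where "M = 2 * exp a * K"
  have qper: "periodic (q \<delta>)" for \<delta>
    using transfer_periodic[of "Tp \<delta>" w] transfer_periodic[of T w] by (simp add: q_def periodic_def)
  have q0: "periodic q0" "continuous_on UNIV q0"
    unfolding q0_def
    by (intro transfer_periodic transfer_continuous transfer_variation_regular[OF w(1,2) wc(2)])+
  have lim: "bounded_uniform_limit UNIV (\<lambda>\<delta>. (transfer (Tp \<delta>) ^^ n) (q \<delta>)) ((transfer T ^^ n) q0) (at_right 0)" for n
    by (rule transfer_pow_limit[OF q0])
      (use first_order_response[OF w(1,2) wc(2)] qper in \<open>auto simp: q_def q0_def\<close>)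
  have dec: "\<forall>\<^sub>F \<delta> in at_right 0. \<forall>n x. \<bar>(transfer (Tp \<delta>) ^^ n) (q \<delta>) x\<bar> \<le> M * \<theta> ^ n"
    using K(2) family_lift
  proof eventually_elim
    case (elim \<delta>)
    interpret L: expanding_lift "Tp \<delta>" "Tp1 \<delta>" "Tp2 \<delta>" d l D by (rule elim(2))
    have "integral {0..1} (q \<delta>) = (integral {0..1} (transfer (Tp \<delta>) w) - integral {0..1} (transfer T w)) / \<delta>"
      unfolding q_def using w wc
      by (simp add: integral_divide integral_diff int L.transfer_continuous transfer_continuous)
    also have "\<dots> = 0" using L.transfer_integral[OF w(1) wc(1)] transfer_integral[OF w(1) wc(1)] by simp
    finally show ?case
      using L.zero_average_decay[OF qper, of \<delta> "q1 \<delta>" K] elim(1) K(1) by (simp add: M_def \<theta>_def)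
  qed
  have dec0: "\<bar>(transfer T ^^ n) q0 x\<bar> \<le> M * \<theta> ^ n" for n x
  proof (rule tendsto_upperbound)
    show "((\<lambda>\<delta>. \<bar>(transfer (Tp \<delta>) ^^ n) (q \<delta>) x\<bar>) \<longlongrightarrow> \<bar>(transfer T ^^ n) q0 x\<bar>) (at_right 0)"
      by (intro tendsto_rabs tendsto_uniform_limitI[where S = UNIV]) (use lim in \<open>auto simp: bounded_uniform_limit_def\<close>)
    show "\<forall>\<^sub>F \<delta> in at_right 0. \<bar>(transfer (Tp \<delta>) ^^ n) (q \<delta>) x\<bar> \<le> M * \<theta> ^ n"
      using dec by eventually_elim auto
  qed simp
  thus "\<exists>M \<theta>. 0 \<le> \<theta> \<and> \<theta> < 1 \<and> (\<forall>n x. \<bar>(transfer T ^^ n) q0 x\<bar> \<le> M * \<theta> ^ n)"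
    using \<theta> by blast
  have series: "\<forall>\<^sub>F \<delta> in at_right 0. \<forall>x. (\<lambda>n. (transfer (Tp \<delta>) ^^ n) (q \<delta>) x) sums ((g \<delta> x - w x) / \<delta>)"
    using g family_lift eventually_pos
  proof eventually_elim
    case (elim \<delta>)
    interpret L: expanding_lift "Tp \<delta>" "Tp1 \<delta>" "Tp2 \<delta>" d l D by (rule elim(2))
    have gc: "continuous_on UNIV (g \<delta>)"
      by (rule DERIV_continuous_on) (use elim(1) has_field_derivative_at_within in blast)
    show ?case
    proof (intro allI, rule L.neumann_series[where ?u1.0 = "\<lambda>x. (g1 \<delta> x - w1 x) / \<delta>"])
      show "periodic (\<lambda>x. (g \<delta> x - w x) / \<delta>)" using elim w by (simp add: periodic_def)
      show "((\<lambda>x. (g \<delta> x - w x) / \<delta>) has_real_derivative (g1 \<delta> x - w1 x) / \<delta>) (at x)" for x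
        using elim w by (intro DERIV_cdivide DERIV_diff) auto
      show "continuous_on UNIV (\<lambda>x. (g1 \<delta> x - w1 x) / \<delta>)"
        using elim wc by (intro continuous_intros) auto
      show "integral {0..1} (\<lambda>x. (g \<delta> x - w x) / \<delta>) = 0"
        using elim by (simp add: integral_divide integral_diff int gc wc)
      fix x
      have "transfer (Tp \<delta>) (\<lambda>x. (g \<delta> x - w x) / \<delta>) x = (g \<delta> x - transfer (Tp \<delta>) w x) / \<delta>"
        using transfer_linear[of "Tp \<delta>" "1/\<delta>" "g \<delta>" "-1/\<delta>" w x] elim(1) by (simp add: diff_divide_distrib)
      thus "(g \<delta> x - w x) / \<delta> - transfer (Tp \<delta>) (\<lambda>x. (g \<delta> x - w x) / \<delta>) x = q \<delta> x"
        by (simp add: q_def fixed diff_divide_distrib)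
    qed
  qed
  show "uniform_limit UNIV (\<lambda>\<delta> x. (g \<delta> x - w x) / \<delta>) (\<lambda>x. \<Sum>n. (transfer T ^^ n) q0 x) (at_right 0)"
  proof (rule uniform_limitI)
    fix e :: real assume "0 < e"
    have "(\<lambda>N. M * \<theta> ^ N / (1 - \<theta>)) \<longlonglongrightarrow> M * 0 / (1 - \<theta>)"
      using \<theta> by (intro tendsto_intros LIMSEQ_power_zero) auto
    hence "\<forall>\<^sub>F N in sequentially. M * \<theta> ^ N / (1 - \<theta>) < e / 4"
      using \<open>0 < e\<close> by (intro order_tendstoD) auto
    then obtain N where N: "M * \<theta> ^ N / (1 - \<theta>) < e / 4"
      by (auto simp: eventually_sequentially)
    have "bounded_uniform_limit UNIV (\<lambda>\<delta> x. \<Sum>n<N. (transfer (Tp \<delta>) ^^ n) (q \<delta>) x)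
        (\<lambda>x. \<Sum>n<N. (transfer T ^^ n) q0 x) (at_right 0)"
      by (rule bul_sum) (rule lim)
    from bul_eventually_le[OF this, of "e / 4"]
    have "\<forall>\<^sub>F \<delta> in at_right 0. \<forall>x\<in>UNIV.
        \<bar>(\<Sum>n<N. (transfer (Tp \<delta>) ^^ n) (q \<delta>) x) - (\<Sum>n<N. (transfer T ^^ n) q0 x)\<bar> \<le> e / 4"
      using \<open>0 < e\<close> by simp
    thus "\<forall>\<^sub>F \<delta> in at_right 0. \<forall>x\<in>UNIV. dist ((g \<delta> x - w x) / \<delta>) (\<Sum>n. (transfer T ^^ n) q0 x) < e"
      using series dec
    proof eventually_elim
      case (elim \<delta>)
      show ?case
      proof
        fix x
        let ?b = "\<lambda>n. (transfer (Tp \<delta>) ^^ n) (q \<delta>) x" and ?r = "\<lambda>n. (transfer T ^^ n) q0 x"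
        have "suminf ?b = (g \<delta> x - w x) / \<delta>" using elim(2) by (simp add: sums_iff)
        moreover have "\<bar>suminf ?b - (\<Sum>n<N. ?b n)\<bar> \<le> M * \<theta> ^ N / (1 - \<theta>)"
          by (rule geometric_tail(2)) (use elim(3) \<theta> in auto)
        moreover have "\<bar>suminf ?r - (\<Sum>n<N. ?r n)\<bar> \<le> M * \<theta> ^ N / (1 - \<theta>)"
          by (rule geometric_tail(2)) (use dec0 \<theta> in auto)
        moreover have "\<bar>(\<Sum>n<N. ?b n) - (\<Sum>n<N. ?r n)\<bar> \<le> e / 4" using elim(1) by simp
        ultimately show "dist ((g \<delta> x - w x) / \<delta>) (\<Sum>n. ?r n) < e"
          using N \<open>0 < e\<close> unfolding dist_real_def by linarith
      qed
    qed
  qed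
qed

end

section \<open>Smooth functions on the circle\<close>

lemma Ck_has_derivative:
  assumes "Ck k f" "i < k"
  shows "((deriv ^^ i) f has_real_derivative (deriv ^^ Suc i) f x) (at x)"
  using assms by (simp add: Ck_def DERIV_deriv_iff_real_differentiable)

lemma Ck_continuous:
  assumes "Ck k f" "i \<le> k"
  shows "continuous_on UNIV ((deriv ^^ i) f)"
proof (cases "i = k")
  case True
  thus ?thesis using assms by (simp add: Ck_def)
next
  case False
  hence "i < k" using assms by simp
  from Ck_has_derivative[OF assms(1) this] show ?thesis
    by (intro DERIV_continuous_on) (rule has_field_derivative_at_within)
qed

lemma Ck_periodic:
  assumes "Ck k f" "periodic f" "i \<le> k"
  shows "periodic ((deriv ^^ i) f)"
  using assms(3)
proof (induction i)
  case (Suc i)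
  show ?case
    by (rule periodic_deriv[OF Ck_has_derivative[OF assms(1), of i]]) (use Suc in auto)
qed (simp add: assms)

lemma Ck_norm_bound:
  assumes "Ck k f" "periodic f" "i \<le> k"
  shows "\<bar>(deriv ^^ i) f x\<bar> \<le> Ck_norm k f"
proof -
  have le: "\<bar>(deriv ^^ j) f y\<bar> \<le> (SUP x. \<bar>(deriv ^^ j) f x\<bar>)" if j: "j \<le> k" for j y
  proof -
    obtain K where "\<And>x. \<bar>(deriv ^^ j) f x\<bar> \<le> K"
      using periodic_continuous_bound[OF Ck_periodic[OF assms(1,2) j] Ck_continuous[OF assms(1) j]] by blast
    hence "bdd_above (range (\<lambda>x. \<bar>(deriv ^^ j) f x\<bar>))" by (auto simp: bdd_above_def)
    thus ?thesis by (intro cSUP_upper) auto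
  qed
  have "(SUP x. \<bar>(deriv ^^ i) f x\<bar>) \<le> Ck_norm k f"
    unfolding Ck_norm_def
  proof (rule member_le_sum)
    show "0 \<le> (SUP x. \<bar>(deriv ^^ j) f x\<bar>)" if "j \<in> {..k} - {i}" for j
      using le[of j 0] that by (meson DiffD1 abs_ge_zero atMost_iff order_trans)
  qed (use assms in auto)
  thus ?thesis using le[OF assms(3), of x] by simp
qed

text \<open>
  The difference \<open>T (x + 1) - T x\<close> is a continuous integer-valued function, hence a constant, and it is positive
  since \<open>T\<close> increases. Compactness of the circle provides the bounds on the derivatives.
\<close>

lemma smooth_expanding_lift:
  assumes lift: "lift_of_circle_map T" and C: "Ck 3 T" and ex: "expanding T" and or: "orientation_preserving T"
  obtains d l D where "expanding_lift T (deriv T) (deriv (deriv T)) d l D"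
proof -
  have D0: "(T has_real_derivative deriv T x) (at x)"
    and D1: "(deriv T has_real_derivative deriv (deriv T) x) (at x)" for x
    using Ck_has_derivative[OF C, of 0] Ck_has_derivative[OF C, of 1] by simp_all
  have c: "continuous_on UNIV T" "continuous_on UNIV (deriv T)" "continuous_on UNIV (deriv (deriv T))"
    using Ck_continuous[OF C, of 0] Ck_continuous[OF C, of 1] Ck_continuous[OF C, of 2]
    by (simp_all add: numeral_2_eq_2)
  have gt1: "1 < deriv T x" for x
    using ex or by (simp add: expanding_def orientation_preserving_def abs_if split: if_splits) (meson order_less_asym)
  have shift: "continuous_on UNIV (\<lambda>x. T (x + 1))"
    by (rule continuous_on_compose2[OF c(1)]) (auto intro!: continuous_intros)
  have const: "T (x + 1) - T x = T (0 + 1) - T 0" for x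
    by (rule continuous_Ints_constant[where f = "\<lambda>x. T (x + 1) - T x"])
      (use lift shift c in \<open>auto simp: lift_of_circle_map_def intro!: continuous_intros\<close>)
  obtain k where k: "T (0 + 1) - T 0 = of_int k"
    using lift unfolding lift_of_circle_map_def by (metis Ints_cases)
  obtain z where "T 1 - T 0 = (1 - 0) * deriv T z"
    using MVT2[of 0 1 T "deriv T"] D0 by auto
  hence "0 < real_of_int k" using k gt1[of z] by simp
  hence k_pos: "0 < k" by simp
  have deg: "T (x + 1) = T x + real (nat k)" for x using const[of x] k k_pos by simp
  have per: "periodic (deriv T)" using quasi_periodic_deriv[OF D0 deg] .
  have per2: "periodic (deriv (deriv T))" using periodic_deriv[OF D1 per] .
  obtain x0 where x0: "x0 \<in> {0..1}" "\<And>y. y \<in> {0..1} \<Longrightarrow> deriv T x0 \<le> deriv T y"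
    using continuous_attains_inf[of "{0..1::real}" "deriv T"]
      continuous_on_subset[OF c(2) subset_UNIV, of "{0..1}"] by auto
  have "deriv T x0 \<le> deriv T y" for y
    using x0(2)[of "frac y"] periodic_frac[OF per, of y] frac_lt_1[of y] by simp
  moreover obtain D where "\<And>x. \<bar>deriv (deriv T) x\<bar> \<le> D"
    using periodic_continuous_bound[OF per2 c(3)] by blast
  ultimately have "expanding_lift T (deriv T) (deriv (deriv T)) (nat k) (deriv T x0) D"
    by unfold_locales (use D0 D1 deg gt1 in auto)
  thus thesis by (rule that)
qed

text \<open>
  The operator depends only on the circle map and not on the chosen lift, which makes it
  possible to normalise the lifts of a family.
\<close>

lemma transfer_lift_cong:
  assumes "\<And>x. T x - T' x \<in> \<int>" "\<And>x. deriv T x = deriv T' x"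
  shows "transfer T = transfer T'"
proof (intro ext)
  fix f x
  have "T y - x \<in> \<int> \<longleftrightarrow> T' y - x \<in> \<int>" for y
    using Ints_diff[OF _ assms(1)[of y], of "T y - x"] Ints_add[OF _ assms(1)[of y], of "T' y - x"]
    by (auto simp: algebra_simps)
  thus "transfer T f x = transfer T' f x" by (simp add: transfer_def assms(2))
qed

lemma deriv_cong_Ints:
  assumes "\<And>x. (T has_real_derivative deriv T x) (at x)" "\<And>x. (T' has_real_derivative T1' x) (at x)"
    and "\<And>x. T x - T' x \<in> \<int>"
  shows "deriv T x = T1' x"
proof -
  have "continuous_on UNIV (\<lambda>x. T x - T' x)"
    using assms by (intro continuous_on_diff DERIV_continuous_on) (auto intro: has_field_derivative_at_within)
  hence "T x - T' x = T 0 - T' 0" for x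
    using assms(3) continuous_Ints_constant[of "\<lambda>x. T x - T' x"] by blast
  hence "T = (\<lambda>x. T' x + (T 0 - T' 0))" by (auto simp: fun_eq_iff algebra_simps)
  moreover have "((\<lambda>x. T' x + (T 0 - T' 0)) has_real_derivative T1' x) (at x)"
    by (auto intro!: derivative_eq_intros assms)
  ultimately show ?thesis using DERIV_imp_deriv by metis
qed

section \<open>Convergence in mean\<close>

lemma continuous_periodic_L1: "periodic f \<Longrightarrow> continuous_on UNIV f \<Longrightarrow> f \<in> L1"
  by (simp add: L1_def circle_integral)

lemma L1_norm_nonneg: "0 \<le> L1_norm f"
  by (simp add: L1_norm_def)

lemma L1_norm_minus_commute: "L1_norm (\<lambda>x. f x - g x) = L1_norm (\<lambda>x. g x - f x)"
  by (simp add: L1_norm_def abs_minus_commute)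

lemma L1_norm_triangle:
  assumes "f \<in> L1" "g \<in> L1" "h \<in> L1"
  shows "L1_norm (\<lambda>x. f x - h x) \<le> L1_norm (\<lambda>x. f x - g x) + L1_norm (\<lambda>x. g x - h x)"
proof -
  have i: "integrable circle_measure f" "integrable circle_measure g" "integrable circle_measure h"
    using assms by (auto simp: L1_def)
  have "L1_norm (\<lambda>x. f x - h x) \<le> (\<integral>x. \<bar>f x - g x\<bar> + \<bar>g x - h x\<bar> \<partial>circle_measure)"
    unfolding L1_norm_def by (rule integral_mono) (use i in auto)
  also have "\<dots> = L1_norm (\<lambda>x. f x - g x) + L1_norm (\<lambda>x. g x - h x)"
    unfolding L1_norm_def by (rule Bochner_Integration.integral_add) (use i in auto)
  finally show ?thesis .
qed

lemma L1_tendsto_unique: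
  assumes "L1_tendsto u a F" "L1_tendsto u b F" "F \<noteq> bot"
  shows "L1_norm (\<lambda>x. a x - b x) = 0"
proof -
  have ab: "a \<in> L1" "b \<in> L1" using assms by (auto simp: L1_tendsto_def)
  have "((\<lambda>i. L1_norm (\<lambda>x. u i x - a x) + L1_norm (\<lambda>x. u i x - b x)) \<longlongrightarrow> 0 + 0) F"
    using assms by (intro tendsto_add) (auto simp: L1_tendsto_def)
  moreover have "\<forall>\<^sub>F i in F. L1_norm (\<lambda>x. a x - b x) \<le> L1_norm (\<lambda>x. u i x - a x) + L1_norm (\<lambda>x. u i x - b x)"
  proof -
    have "\<forall>\<^sub>F i in F. u i \<in> L1" using assms by (simp add: L1_tendsto_def)
    thus ?thesis
    proof eventually_elim
      case (elim i)
      show ?case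
        using L1_norm_triangle[OF ab(1) elim ab(2)] L1_norm_minus_commute[of a "u i"] by simp
    qed
  qed
  ultimately have "L1_norm (\<lambda>x. a x - b x) \<le> 0 + 0"
    by (rule tendsto_lowerbound) (rule assms)
  thus ?thesis using L1_norm_nonneg[of "\<lambda>x. a x - b x"] by simp
qed

lemma L1_tendsto_change_limit:
  assumes "L1_tendsto u a F" "b \<in> L1" "L1_norm (\<lambda>x. a x - b x) = 0"
  shows "L1_tendsto u b F"
proof -
  have a: "a \<in> L1" and u: "\<forall>\<^sub>F i in F. u i \<in> L1" and lim: "((\<lambda>i. L1_norm (\<lambda>x. u i x - a x)) \<longlongrightarrow> 0) F"
    using assms by (auto simp: L1_tendsto_def)
  have "((\<lambda>i. L1_norm (\<lambda>x. u i x - b x)) \<longlongrightarrow> 0) F"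
  proof (rule Lim_null_comparison[OF _ lim])
    show "\<forall>\<^sub>F i in F. norm (L1_norm (\<lambda>x. u i x - b x)) \<le> L1_norm (\<lambda>x. u i x - a x)"
      using u
    proof eventually_elim
      case (elim i)
      show ?case using L1_norm_triangle[OF elim a assms(2)] assms(3) L1_norm_nonneg by simp
    qed
  qed
  thus ?thesis using u assms(2) by (simp add: L1_tendsto_def)
qed

lemma uniform_limit_L1_tendsto:
  assumes lim: "uniform_limit UNIV u h F" and u: "\<forall>\<^sub>F i in F. periodic (u i) \<and> continuous_on UNIV (u i)"
    and h: "periodic h" "continuous_on UNIV h"
  shows "L1_tendsto u h F"
  unfolding L1_tendsto_def
proof (intro conjI)
  show "h \<in> L1" using h by (rule continuous_periodic_L1)
  show "\<forall>\<^sub>F i in F. u i \<in> L1" using u by eventually_elim (auto intro: continuous_periodic_L1)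
  show "((\<lambda>i. L1_norm (\<lambda>x. u i x - h x)) \<longlongrightarrow> 0) F"
  proof (rule tendstoI)
    fix e :: real assume "0 < e"
    hence "\<forall>\<^sub>F i in F. \<forall>x\<in>UNIV. dist (u i x) (h x) < e / 2" by (intro uniform_limitD[OF lim]) simp
    thus "\<forall>\<^sub>F i in F. dist (L1_norm (\<lambda>x. u i x - h x)) 0 < e"
      using u
    proof eventually_elim
      case (elim i)
      have c: "continuous_on UNIV (\<lambda>x. \<bar>u i x - h x\<bar>)" using elim h by (intro continuous_intros) auto
      have "L1_norm (\<lambda>x. u i x - h x) = integral {0..1} (\<lambda>x. \<bar>u i x - h x\<bar>)"
        unfolding L1_norm_def by (rule circle_integral(2)[OF c])
      also have "\<dots> \<le> integral {0..1} (\<lambda>_::real. e / 2)"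
        using c elim(1)
        by (intro integral_le integrable_continuous_real)
          (auto simp: dist_real_def less_imp_le intro: continuous_on_subset)
      also have "\<dots> < e" using \<open>0 < e\<close> by simp
      finally show ?case using L1_norm_nonneg[of "\<lambda>x. u i x - h x"] by (simp add: dist_real_def)
    qed
  qed
qed

lemma lipschitz_abs_continuous:
  assumes "0 < K" "\<And>x y. \<bar>f x - f y\<bar> \<le> K * \<bar>x - y\<bar>"
  shows "abs_continuous f"
  unfolding abs_continuous_def
proof (intro allI impI)
  fix e :: real assume "0 < e"
  show "\<exists>r>0. \<forall>n a b. (\<forall>i<n. 0 \<le> a i \<and> a i \<le> b i \<and> b i \<le> 1) \<and>
      disjoint_family_on (\<lambda>i. {a i<..<b i}) {..<n::nat} \<and> (\<Sum>i<n. b i - a i) < r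
      \<longrightarrow> (\<Sum>i<n. \<bar>f (b i) - f (a i)\<bar>) < e"
  proof (intro exI[of _ "e / K"] conjI allI impI, goal_cases)
    case 1
    show ?case using assms \<open>0 < e\<close> by simp
  next
    case (2 n a b)
    have "(\<Sum>i<n. \<bar>f (b i) - f (a i)\<bar>) \<le> (\<Sum>i<n. K * (b i - a i))"
    proof (rule sum_mono)
      fix i assume "i \<in> {..<n}"
      hence "a i \<le> b i" using 2 by auto
      thus "\<bar>f (b i) - f (a i)\<bar> \<le> K * (b i - a i)" using assms(2)[of "b i" "a i"] by simp
    qed
    also have "\<dots> = K * (\<Sum>i<n. b i - a i)" by (simp add: sum_distrib_left)
    also have "\<dots> < K * (e / K)" using 2 assms(1) by (intro mult_strict_left_mono) auto
    also have "\<dots> = e" using assms(1) by simp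
    finally show ?case .
  qed
qed

lemma bounded_deriv_lipschitz:
  fixes f :: "real \<Rightarrow> real"
  assumes "\<And>x. (f has_real_derivative f1 x) (at x)" "\<And>x. \<bar>f1 x\<bar> \<le> K"
  shows "\<bar>f x - f y\<bar> \<le> K * \<bar>x - y\<bar>"
  using field_differentiable_bound[of UNIV f f1 K x y] assms by simp

section \<open>The variation formula\<close>

lemma Ldot_eq_transfer_variation:
  "Ldot T V w = transfer T (transfer_variation (deriv T) (deriv (deriv T)) V (deriv V) w (deriv w))"
proof
  fix x
  have "transfer T (transfer_variation (deriv T) (deriv (deriv T)) V (deriv V) w (deriv w)) x =
    transfer T (\<lambda>y. (-1) * (w y * deriv V y / deriv T y) + 1 * (
      (-1) * (V y * deriv w y / deriv T y) + 1 * (V y * deriv (deriv T) y / (deriv T y)\<^sup>2 * w y))) x"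
    by (simp add: transfer_variation_def[abs_def] algebra_simps)
  also have "\<dots> = Ldot T V w x" unfolding transfer_linear by (simp add: Ldot_def)
  finally show "Ldot T V w x = transfer T (transfer_variation (deriv T) (deriv (deriv T)) V (deriv V) w (deriv w)) x" ..
qed

text \<open>
  The zero average comes from \<open>transfer_variation T1 T2 V V1 w w1 = - (w * V / T1)'\<close>: the derivative of
  a periodic function has integral \<open>0\<close> over a period, and the transfer operator preserves integrals.
  Absolute continuity follows from a Lipschitz bound.
\<close>

lemma (in expanding_lift) transfer_variation_W11:
  assumes T2: "\<And>x. (T2 has_real_derivative T3 x) (at x)" "continuous_on UNIV T3"
    and V: "periodic V" "\<And>x. (V has_real_derivative V1 x) (at x)" "\<And>x. (V1 has_real_derivative V2 x) (at x)"
      "continuous_on UNIV V2"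
    and w: "periodic w" "\<And>x. (w has_real_derivative w1 x) (at x)" "\<And>x. (w1 has_real_derivative w2 x) (at x)"
      "continuous_on UNIV w2"
  shows "transfer T (transfer_variation T1 T2 V V1 w w1) \<in> W11_zero_average"
proof -
  define p where "p = transfer_variation T1 T2 V V1 w w1"
  define p1 where "p1 = (\<lambda>y. - (((w1 y * V1 y + w y * V2 y) * T1 y - w y * V1 y * T2 y) / (T1 y)\<^sup>2)
    - ((V1 y * w1 y + V y * w2 y) * T1 y - V y * w1 y * T2 y) / (T1 y)\<^sup>2
    + (((V1 y * T2 y + V y * T3 y) * (T1 y)\<^sup>2 - V y * T2 y * (2 * T1 y * T2 y)) / (T1 y) ^ 4 * w y
       + V y * T2 y / (T1 y)\<^sup>2 * w1 y))"
  have cont: "continuous_on UNIV w" "continuous_on UNIV w1" "continuous_on UNIV V" "continuous_on UNIV V1"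
    "continuous_on UNIV T2"
    by (rule DERIV_continuous_on, rule has_field_derivative_at_within, rule w V T2)+
  have w1: "periodic w1" and V1: "periodic V1" using w V periodic_deriv by blast+
  have p: "periodic p" "continuous_on UNIV p"
    unfolding p_def transfer_variation_def
    using w w1 V V1 T1_periodic T2_periodic cont T1_cont T1_nz
    by (auto simp: periodic_def intro!: continuous_intros)
  have p': "(p has_real_derivative p1 x) (at x)" for x
    unfolding p_def p1_def transfer_variation_def[abs_def] using T1_nz[of x]
    by (auto intro!: derivative_eq_intros w V T2 deriv_T1 simp: field_simps power2_eq_square power4_eq_xxxx)
  have p1: "periodic p1" "continuous_on UNIV p1"
    using periodic_deriv[OF p' p(1)] unfolding p1_def
    by (auto intro!: continuous_intros w V T2 cont T1_cont simp: T1_nz)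
  define r where "r = (\<lambda>y. p1 y / T1 y - p y * T2 y / (T1 y)\<^sup>2)"
  have r: "periodic r" "continuous_on UNIV r"
    unfolding r_def using p p1 T1_periodic T2_periodic cont T1_cont T1_nz
    by (auto simp: periodic_def intro!: continuous_intros)
  obtain K where K: "0 < K" "\<And>x. \<bar>transfer T r x\<bar> \<le> K"
    using periodic_continuous_bound[OF transfer_periodic transfer_continuous[OF r]] by blast
  have "abs_continuous (transfer T p)"
    by (rule lipschitz_abs_continuous[OF K(1)])
      (rule bounded_deriv_lipschitz[OF transfer_deriv[OF p(1) p', folded r_def] K(2)])
  moreover have "(\<integral>x. transfer T p x \<partial>circle_measure) = 0"
  proof -
    have "((\<lambda>y. - (w y * V y / T1 y)) has_real_derivative p x) (at x)" for x
      unfolding p_def transfer_variation_def using T1_nz[of x]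
      by (auto intro!: derivative_eq_intros w V deriv_T1 simp: field_simps power2_eq_square)
    from integral_eq_primitive[OF this]
    have "integral {0..1} p = - (w 1 * V 1 / T1 1) + w 0 * V 0 / T1 0" by simp
    also have "\<dots> = 0" using w(1) V(1) T1_periodic unfolding periodic_def by (metis add_0 add.left_inverse)
    finally show ?thesis
      using circle_integral(2)[OF transfer_continuous[OF p]] transfer_integral[OF p] by simp
  qed
  ultimately show ?thesis
    unfolding p_def[symmetric] W11_zero_average_def by (simp add: transfer_periodic)
qed

section \<open>Linear response in mean\<close>

text \<open>
  The expansion of \<open>T 0\<close> leaves a gap \<open>l0 - 1\<close>. For small \<open>\<delta>\<close> the derivatives of the perturbation are
  below \<open>e = min 1 ((l0 - 1) / 2)\<close>, so that all maps of the segment expand at least by \<open>(1 + l0) / 2\<close> and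
  have second derivative at most \<open>D0 + 1\<close>.
\<close>

lemma smooth_perturbed_family:
  fixes T rem :: "real \<Rightarrow> real \<Rightarrow> real" and V :: "real \<Rightarrow> real"
  assumes "0 < \<delta>max"
    and T0: "lift_of_circle_map (T 0)" "Ck 3 (T 0)" "expanding (T 0)" "orientation_preserving (T 0)"
    and V: "periodic V" "Ck 3 V"
    and rem: "\<And>\<delta>. \<delta> \<in> {0..<\<delta>max} \<Longrightarrow> periodic (rem \<delta>)" "\<And>\<delta>. \<delta> \<in> {0..<\<delta>max} \<Longrightarrow> Ck 3 (rem \<delta>)"
      "((\<lambda>\<delta>. Ck_norm 3 (rem \<delta>) / \<delta>) \<longlongrightarrow> 0) (at_right 0)"
  obtains d l D where "perturbed_family (T 0) (deriv (T 0)) (deriv (deriv (T 0))) d l D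
    V (deriv V) (deriv (deriv V)) rem (\<lambda>\<delta>. deriv (rem \<delta>)) (\<lambda>\<delta>. deriv (deriv (rem \<delta>)))"
proof -
  obtain d l0 D0 where L0: "expanding_lift (T 0) (deriv (T 0)) (deriv (deriv (T 0))) d l0 D0"
    using smooth_expanding_lift[OF T0] .
  interpret L0: expanding_lift "T 0" "deriv (T 0)" "deriv (deriv (T 0))" d l0 D0 by (rule L0)
  have range: "\<forall>\<^sub>F \<delta> in at_right 0. \<delta> \<in> {0<..<\<delta>max}"
    using assms(1) by (rule eventually_at_right_real)
  have D: "(f has_real_derivative deriv f x) (at x)" "(deriv f has_real_derivative deriv (deriv f) x) (at x)"
    "continuous_on UNIV (deriv f)" "continuous_on UNIV (deriv (deriv f))"
    if "Ck 3 f" for f x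
    using Ck_has_derivative[OF that, of 0] Ck_has_derivative[OF that, of 1]
      Ck_continuous[OF that, of 1] Ck_continuous[OF that, of 2] by (simp_all add: numeral_2_eq_2)
  have small: "bounded_uniform_limit UNIV (\<lambda>\<delta> x. (deriv ^^ i) (rem \<delta>) x / \<delta>) (\<lambda>_. 0) (at_right 0)"
    if "i \<le> 2" for i
  proof (rule bulI)
    fix e :: real assume "0 < e"
    hence "\<forall>\<^sub>F \<delta> in at_right 0. Ck_norm 3 (rem \<delta>) / \<delta> < e" by (rule order_tendstoD(2)[OF rem(3)])
    thus "\<forall>\<^sub>F \<delta> in at_right 0. \<forall>x\<in>UNIV. \<bar>(deriv ^^ i) (rem \<delta>) x / \<delta> - 0\<bar> \<le> e"
      using range
    proof eventually_elim
      case (elim \<delta>)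
      have "\<bar>(deriv ^^ i) (rem \<delta>) x\<bar> / \<delta> \<le> Ck_norm 3 (rem \<delta>) / \<delta>" for x
        using elim that by (intro divide_right_mono Ck_norm_bound rem) auto
      thus ?case using elim by (auto simp: abs_divide intro: order_trans less_imp_le)
    qed
  qed auto
  have lim0: "bounded_uniform_limit UNIV (\<lambda>\<delta> x. \<delta> * (v x + r \<delta> x / \<delta>)) (\<lambda>_. 0) (at_right 0)"
    if "periodic v" "continuous_on UNIV v"
      "bounded_uniform_limit UNIV (\<lambda>\<delta> x. r \<delta> x / \<delta>) (\<lambda>_. 0) (at_right 0)" for v r
    using bul_mult[OF bul_parameter[OF tendsto_ident_at]
        bul_add[OF bul_const[OF periodic_bounded_range[OF that(1,2)]] that(3)]] by simp
  define e where "e = min 1 ((l0 - 1) / 2)"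
  have e: "0 < e" using L0.l_gt_1 by (simp add: e_def)
  define l where "l = (1 + l0) / 2"
  have Vp: "periodic (deriv V)" "periodic (deriv (deriv V))"
    using Ck_periodic[OF V(2,1), of 1] Ck_periodic[OF V(2,1), of 2] by (simp_all add: numeral_2_eq_2)
  have small1: "bounded_uniform_limit UNIV (\<lambda>\<delta> x. deriv (rem \<delta>) x / \<delta>) (\<lambda>_. 0) (at_right 0)"
    and small2: "bounded_uniform_limit UNIV (\<lambda>\<delta> x. deriv (deriv (rem \<delta>)) x / \<delta>) (\<lambda>_. 0) (at_right 0)"
    using small[of 1] small[of 2] by (simp_all add: numeral_2_eq_2)
  have "perturbed_family (T 0) (deriv (T 0)) (deriv (deriv (T 0))) d l (D0 + 1)
    V (deriv V) (deriv (deriv V)) rem (\<lambda>\<delta>. deriv (rem \<delta>)) (\<lambda>\<delta>. deriv (deriv (rem \<delta>)))"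
  proof unfold_locales
    show "(T 0 has_real_derivative deriv (T 0) x) (at x)"
      "(deriv (T 0) has_real_derivative deriv (deriv (T 0)) x) (at x)"
      "T 0 (x + 1) = T 0 x + real d" for x
      by (rule L0.deriv_T L0.deriv_T1 L0.degree)+
    show "1 < l" using L0.l_gt_1 by (simp add: l_def)
    show "l \<le> deriv (T 0) x" for x using L0.l_gt_1 L0.T1_ge[of x] by (simp add: l_def)
    show "\<bar>deriv (deriv (T 0)) x\<bar> \<le> D0 + 1" for x using L0.T2_le[of x] by simp
    show "continuous_on UNIV (deriv (deriv (T 0)))" by (rule D(4)[OF T0(2)])
    show "periodic V" by (rule V)
    show "(V has_real_derivative deriv V x) (at x)" "(deriv V has_real_derivative deriv (deriv V) x) (at x)" for x
      by (rule D(1,2)[OF V(2)])+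
    show "continuous_on UNIV (deriv (deriv V))" by (rule D(4)[OF V(2)])
    show "\<forall>\<^sub>F \<delta> in at_right 0. periodic (rem \<delta>) \<and> (\<forall>x. (rem \<delta> has_real_derivative deriv (rem \<delta>) x) (at x) \<and>
        (deriv (rem \<delta>) has_real_derivative deriv (deriv (rem \<delta>)) x) (at x))"
      using range
    proof eventually_elim
      case (elim \<delta>)
      hence \<delta>: "\<delta> \<in> {0..<\<delta>max}" by auto
      show ?case using rem(1)[OF \<delta>] D(1,2)[OF rem(2)[OF \<delta>]] by blast
    qed
    show "bounded_uniform_limit UNIV (\<lambda>\<delta> x. rem \<delta> x / \<delta>) (\<lambda>_. 0) (at_right 0)"
      using small[of 0] by simp
    show "bounded_uniform_limit UNIV (\<lambda>\<delta> x. deriv (rem \<delta>) x / \<delta>) (\<lambda>_. 0) (at_right 0)"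
      "bounded_uniform_limit UNIV (\<lambda>\<delta> x. deriv (deriv (rem \<delta>)) x / \<delta>) (\<lambda>_. 0) (at_right 0)"
      by (rule small1 small2)+
    show "\<forall>\<^sub>F \<delta> in at_right 0. \<forall>s\<in>{0..1}. expanding_lift (\<lambda>y. T 0 y + s * (\<delta> * V y + rem \<delta> y))
      (\<lambda>y. deriv (T 0) y + s * (\<delta> * deriv V y + deriv (rem \<delta>) y))
      (\<lambda>y. deriv (deriv (T 0)) y + s * (\<delta> * deriv (deriv V) y + deriv (deriv (rem \<delta>)) y)) d l (D0 + 1)"
      using range bul_eventually_le[OF lim0[OF Vp(1) D(3)[OF V(2)] small1] e]
        bul_eventually_le[OF lim0[OF Vp(2) D(4)[OF V(2)] small2] e]
    proof eventually_elim
      case (elim \<delta>)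
      have \<delta>: "0 < \<delta>" "\<delta> \<in> {0..<\<delta>max}" using elim by auto
      have b1: "\<bar>\<delta> * deriv V y + deriv (rem \<delta>) y\<bar> \<le> e" for y
        using elim(2)[rule_format, of y] \<delta> by (simp add: distrib_left)
      have b2: "\<bar>\<delta> * deriv (deriv V) y + deriv (deriv (rem \<delta>)) y\<bar> \<le> e" for y
        using elim(3)[rule_format, of y] \<delta> by (simp add: distrib_left)
      show ?case
      proof
        fix s :: real assume s: "s \<in> {0..1}"
        have sb: "\<bar>s * u\<bar> \<le> e" if "\<bar>u\<bar> \<le> e" for u
          using mult_mono[of "\<bar>s\<bar>" 1 "\<bar>u\<bar>" e] s that by (simp add: abs_mult)
        show "expanding_lift (\<lambda>y. T 0 y + s * (\<delta> * V y + rem \<delta> y))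
          (\<lambda>y. deriv (T 0) y + s * (\<delta> * deriv V y + deriv (rem \<delta>) y))
          (\<lambda>y. deriv (deriv (T 0)) y + s * (\<delta> * deriv (deriv V) y + deriv (deriv (rem \<delta>)) y)) d l (D0 + 1)"
        proof
          fix x
          show "((\<lambda>y. T 0 y + s * (\<delta> * V y + rem \<delta> y)) has_real_derivative
              deriv (T 0) x + s * (\<delta> * deriv V x + deriv (rem \<delta>) x)) (at x)"
            by (intro DERIV_add DERIV_cmult L0.deriv_T D V rem \<delta>)
          show "((\<lambda>y. deriv (T 0) y + s * (\<delta> * deriv V y + deriv (rem \<delta>) y)) has_real_derivative
              deriv (deriv (T 0)) x + s * (\<delta> * deriv (deriv V) x + deriv (deriv (rem \<delta>)) x)) (at x)"
            by (intro DERIV_add DERIV_cmult L0.deriv_T1 D V rem \<delta>)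
          show "T 0 (x + 1) + s * (\<delta> * V (x + 1) + rem \<delta> (x + 1)) = T 0 x + s * (\<delta> * V x + rem \<delta> x) + real d"
            using V(1) rem(1)[OF \<delta>(2)] by (simp add: periodic_def L0.degree)
          show "1 < l" using L0.l_gt_1 by (simp add: l_def)
          show "l \<le> deriv (T 0) x + s * (\<delta> * deriv V x + deriv (rem \<delta>) x)"
            using sb[OF b1[of x]] L0.T1_ge[of x] min.cobounded2[of 1 "(l0 - 1) / 2"]
            unfolding l_def e_def[symmetric] by argo
          show "\<bar>deriv (deriv (T 0)) x + s * (\<delta> * deriv (deriv V) x + deriv (deriv (rem \<delta>)) x)\<bar> \<le> D0 + 1"
            using sb[OF b2[of x]] L0.T2_le[of x] unfolding e_def by linarith
        qed
      qed
    qed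
  qed
  thus thesis by (rule that)
qed

theorem proposition58:
  fixes T rem f :: "real \<Rightarrow> real \<Rightarrow> real" and Tdot :: "real \<Rightarrow> real" and \<delta>max :: real
  assumes "\<delta>max > 0"
    and "\<And>\<delta>. \<delta> \<in> {0..<\<delta>max} \<Longrightarrow> lift_of_circle_map (T \<delta>)"
    and "\<And>\<delta>. \<delta> \<in> {0..<\<delta>max} \<Longrightarrow> Ck 3 (T \<delta>)"
    and "\<And>\<delta>. \<delta> \<in> {0..<\<delta>max} \<Longrightarrow> expanding (T \<delta>)"
    and "\<And>\<delta>. \<delta> \<in> {0..<\<delta>max} \<Longrightarrow> orientation_preserving (T \<delta>)"
    and "periodic Tdot" and "Ck 3 Tdot"
    and "\<And>\<delta>. \<delta> \<in> {0..<\<delta>max} \<Longrightarrow> periodic (rem \<delta>)"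
    and "\<And>\<delta>. \<delta> \<in> {0..<\<delta>max} \<Longrightarrow> Ck 3 (rem \<delta>)"
    and "((\<lambda>\<delta>. Ck_norm 3 (rem \<delta>) / \<delta>) \<longlongrightarrow> 0) (at_right 0)"
    and "\<And>\<delta> x. \<delta> \<in> {0..<\<delta>max} \<Longrightarrow> T \<delta> x - (T 0 x + \<delta> * Tdot x + rem \<delta> x) \<in> \<int>"
    and "\<And>\<delta>. \<delta> \<in> {0..<\<delta>max} \<Longrightarrow> invariant_probability_density (T \<delta>) (f \<delta>)"
    and "\<And>\<delta>. \<delta> \<in> {0..<\<delta>max} \<Longrightarrow> Ck 2 (f \<delta>)"
  shows "Ldot (T 0) Tdot (f 0) \<in> W11_zero_average \<and>
    transfer_series_tendsto (T 0) (Ldot (T 0) Tdot (f 0))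
      (resolvent (T 0) (Ldot (T 0) Tdot (f 0))) \<and>
    ((\<lambda>\<delta>. L1_norm (\<lambda>x. (f \<delta> x - f 0 x) / \<delta> - resolvent (T 0) (Ldot (T 0) Tdot (f 0)) x))
      \<longlongrightarrow> 0) (at_right 0) \<and>
    L1_tendsto (\<lambda>\<delta> x. (f \<delta> x - f 0 x) / \<delta>)
      (resolvent (T 0) (Ldot (T 0) Tdot (f 0))) (at_right 0)"
proof -
  have z: "0 \<in> {0..<\<delta>max}" using assms(1) by simp
  have range: "\<forall>\<^sub>F \<delta> in at_right 0. \<delta> \<in> {0<..<\<delta>max}"
    using assms(1) by (rule eventually_at_right_real)
  obtain d l D where "perturbed_family (T 0) (deriv (T 0)) (deriv (deriv (T 0))) d l D
    Tdot (deriv Tdot) (deriv (deriv Tdot)) rem (\<lambda>\<delta>. deriv (rem \<delta>)) (\<lambda>\<delta>. deriv (deriv (rem \<delta>)))"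
    by (rule smooth_perturbed_family[of \<delta>max T Tdot rem]) (use assms z in auto)
  then interpret P: perturbed_family "T 0" "deriv (T 0)" "deriv (deriv (T 0))" d l D
    Tdot "deriv Tdot" "deriv (deriv Tdot)" rem "\<lambda>\<delta>. deriv (rem \<delta>)" "\<lambda>\<delta>. deriv (deriv (rem \<delta>))" .
  have fC: "periodic (f \<delta>)" "continuous_on UNIV (f \<delta>)" "continuous_on UNIV (deriv (f \<delta>))"
    "continuous_on UNIV (deriv (deriv (f \<delta>)))" "(f \<delta> has_real_derivative deriv (f \<delta>) x) (at x)"
    "(deriv (f \<delta>) has_real_derivative deriv (deriv (f \<delta>)) x) (at x)"
    "integral {0..1} (f \<delta>) = 1" "transfer (T \<delta>) (f \<delta>) = f \<delta>"
    if \<delta>: "\<delta> \<in> {0..<\<delta>max}" for \<delta> x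
  proof -
    note C = assms(13)[OF \<delta>] and inv = assms(12)[OF \<delta>]
    show c: "continuous_on UNIV (f \<delta>)" "continuous_on UNIV (deriv (f \<delta>))"
      "continuous_on UNIV (deriv (deriv (f \<delta>)))" "(f \<delta> has_real_derivative deriv (f \<delta>) x) (at x)"
      "(deriv (f \<delta>) has_real_derivative deriv (deriv (f \<delta>)) x) (at x)"
      using Ck_has_derivative[OF C, of 0] Ck_has_derivative[OF C, of 1]
        Ck_continuous[OF C, of 0] Ck_continuous[OF C, of 1] Ck_continuous[OF C, of 2]
      by (simp_all add: numeral_2_eq_2)
    show "periodic (f \<delta>)" using inv by (simp add: invariant_probability_density_def)
    show "integral {0..1} (f \<delta>) = 1"
      using inv circle_integral(2)[OF c(1)] by (simp add: invariant_probability_density_def)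
    obtain d' l' D' where "expanding_lift (T \<delta>) (deriv (T \<delta>)) (deriv (deriv (T \<delta>))) d' l' D'"
      by (rule smooth_expanding_lift[of "T \<delta>"]) (use assms \<delta> in auto)
    thus "transfer (T \<delta>) (f \<delta>) = f \<delta>" by (rule expanding_lift.invariant_density_transfer[OF _ inv c(1)])
  qed
  have C3: "Ck 3 (T 0)" using assms(3) z by blast
  have T3: "(deriv (deriv (T 0)) has_real_derivative deriv (deriv (deriv (T 0))) x) (at x)"
    "continuous_on UNIV (deriv (deriv (deriv (T 0))))" for x
    using Ck_has_derivative[OF C3, of 2] Ck_continuous[OF C3, of 3]
    by (simp_all add: numeral_2_eq_2 numeral_3_eq_3)
  have family: "\<forall>\<^sub>F \<delta> in at_right 0. periodic (f \<delta>) \<and> (\<forall>x. (f \<delta> has_real_derivative deriv (f \<delta>) x) (at x)) \<and>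
      continuous_on UNIV (deriv (f \<delta>)) \<and> transfer (P.Tp \<delta>) (f \<delta>) = f \<delta> \<and> integral {0..1} (f \<delta>) = integral {0..1} (f 0)"
    using range P.family_lift
  proof eventually_elim
    case (elim \<delta>)
    have \<delta>: "\<delta> \<in> {0..<\<delta>max}" using elim by simp
    interpret L: expanding_lift "P.Tp \<delta>" "P.Tp1 \<delta>" "P.Tp2 \<delta>" d l D by (rule elim(2))
    \<comment> \<open>The given lift and the normalised one, \<open>T 0 + \<delta> * Tdot + rem \<delta>\<close>, belong to the same
        circle map.\<close>
    have Z: "T \<delta> x - P.Tp \<delta> x \<in> \<int>" for x using assms(11)[OF \<delta>, of x] by (simp add: P.Tp_def add.assoc)
    have "deriv (T \<delta>) x = P.Tp1 \<delta> x" for x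
      by (rule deriv_cong_Ints[OF _ L.deriv_T Z])
        (use Ck_has_derivative[OF assms(3)[OF \<delta>], of 0] in simp)
    hence "transfer (T \<delta>) = transfer (P.Tp \<delta>)"
      by (intro transfer_lift_cong Z) (simp add: L.deriv_T_eq)
    thus ?case using fC[OF \<delta>] fC(7)[OF z] by simp
  qed
  define q where "q = Ldot (T 0) Tdot (f 0)"
  have q_eq: "q = transfer (T 0) (transfer_variation (deriv (T 0)) (deriv (deriv (T 0))) Tdot (deriv Tdot) (f 0) (deriv (f 0)))"
    unfolding q_def by (rule Ldot_eq_transfer_variation)
  have W11: "q \<in> W11_zero_average"
    unfolding q_eq
    by (rule P.transfer_variation_W11[OF T3 P.V P.V2_cont fC(1)[OF z] fC(5)[OF z] fC(6)[OF z] fC(4)[OF z]])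
  note response = P.uniform_linear_response[OF fC(1)[OF z] fC(5)[OF z] fC(6)[OF z] fC(4)[OF z]
      T3 fC(8)[OF z] family, folded q_eq]
  obtain M \<theta> where M: "0 \<le> \<theta>" "\<theta> < 1" "\<And>n x. \<bar>(transfer (T 0) ^^ n) q x\<bar> \<le> M * \<theta> ^ n"
    using response(1) by blast
  define h where "h = (\<lambda>x. \<Sum>n. (transfer (T 0) ^^ n) q x)"
  have q: "periodic q" "continuous_on UNIV q"
  proof -
    show "periodic q" unfolding q_eq by (rule transfer_periodic)
    show "continuous_on UNIV q"
      unfolding q_eq
      by (intro P.transfer_continuous P.transfer_variation_regular[OF fC(1)[OF z] fC(5)[OF z] fC(3)[OF z]])
  qed
  note pow = P.transfer_pow_periodic_continuous[OF q]
  have partial: "periodic (\<lambda>x. \<Sum>i<n. (transfer (T 0) ^^ i) q x)" "continuous_on UNIV (\<lambda>x. \<Sum>i<n. (transfer (T 0) ^^ i) q x)" for n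
    using pow by (auto simp: periodic_def intro!: continuous_intros)
  have ulim: "uniform_limit UNIV (\<lambda>n x. \<Sum>i<n. (transfer (T 0) ^^ i) q x) h sequentially"
    unfolding h_def
    by (rule Weierstrass_m_test[where M = "\<lambda>n. M * \<theta> ^ n"])
      (use M in \<open>auto intro!: summable_mult summable_geometric\<close>)
  have h: "periodic h" "continuous_on UNIV h"
  proof -
    show "periodic h" using pow by (simp add: h_def periodic_def)
    show "continuous_on UNIV h"
      by (rule uniform_limit_theorem[OF _ ulim]) (use partial in auto)
  qed
  have "transfer_series_tendsto (T 0) q h"
    unfolding transfer_series_tendsto_def
    by (rule uniform_limit_L1_tendsto[OF ulim]) (use partial h in auto)
  \<comment> \<open>The chosen limit \<^const>\<open>resolvent\<close> and the pointwise sum \<open>h\<close> are limits of the same series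
      in mean, hence at distance \<open>0\<close>.\<close>
  moreover from this have res: "transfer_series_tendsto (T 0) q (resolvent (T 0) q)"
    unfolding resolvent_def by (rule someI[where P = "transfer_series_tendsto (T 0) q"])
  ultimately have eq: "L1_norm (\<lambda>x. h x - resolvent (T 0) q x) = 0"
    unfolding transfer_series_tendsto_def by (rule L1_tendsto_unique) simp
  have "L1_tendsto (\<lambda>\<delta> x. (f \<delta> x - f 0 x) / \<delta>) h (at_right 0)"
  proof (rule uniform_limit_L1_tendsto)
    show "uniform_limit UNIV (\<lambda>\<delta> x. (f \<delta> x - f 0 x) / \<delta>) h (at_right 0)"
      unfolding h_def by (rule response(2))
    show "\<forall>\<^sub>F \<delta> in at_right 0. periodic (\<lambda>x. (f \<delta> x - f 0 x) / \<delta>) \<and> continuous_on UNIV (\<lambda>x. (f \<delta> x - f 0 x) / \<delta>)"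
      using range
    proof eventually_elim
      case (elim \<delta>)
      hence \<delta>: "\<delta> \<in> {0..<\<delta>max}" "\<delta> \<noteq> 0" by auto
      show ?case using fC(1,2)[OF \<delta>(1)] fC(1,2)[OF z] \<delta>(2)
        by (auto simp: periodic_def intro!: continuous_intros)
    qed
  qed (rule h)+
  moreover have "resolvent (T 0) q \<in> L1"
    using res by (simp add: transfer_series_tendsto_def L1_tendsto_def)
  ultimately have "L1_tendsto (\<lambda>\<delta> x. (f \<delta> x - f 0 x) / \<delta>) (resolvent (T 0) q) (at_right 0)"
    using eq by (rule L1_tendsto_change_limit)
  with W11 res show ?thesis unfolding q_def by (simp add: L1_tendsto_def)
qed

end
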